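(* Let $K$ be a number field with ring of integers $\mathcal{O}_K$, and let $\{\alpha_i \bmod I_i\}_{i=1}^k$ be an exact covering system of $\mathcal{O}_K$ in which not all the ideals $I_1,\dots,I_k$ are equal. Then for each $i$, the ideal $I_i$ is repeated at least $$\min\Big\{G\Big(\frac{I_i}{I_i+I_j}\Big) \;\Big|\; 1\le j\le k,\ I_j\neq I_i\Big\}$$ times, i.e. $\#\{t \mid I_t=I_i\}$ is at least this number.
   Context: For $\alpha\in\mathcal{O}_K$ and a nonzero ideal $I\neq\mathcal{O}_K$, $\alpha \bmod I$ denotes $\alpha+I$. A family $\{\alpha_i \bmod I_i\}_{i=1}^k$ (each $I_i$ a nonzero proper ideal) is an exact covering system of $\mathcal{O}_K$ if every element of $\mathcal{O}_K$ lies in exactly one set $\alpha_i+I_i$. For nonzero ideals $A\subseteq B$ (i.e. $B\mid A$), $A/B$ denotes the ideal $C$ with $BC=A$. For a nonzero ideal $\mathcal{I}$, $N(\mathcal{I})=|\mathcal{O}_K/\mathcal{I}|$ and $G(\mathcal{I})=\max\{N(\mathfrak{p}^r) \mid \mathfrak{p}^r\mid \mathcal{I},\ \mathfrak{p}\text{ a prime ideal},\ r\ge 0\}$ (so $G(\mathcal{O}_K)=1$). *)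

theory Defs
  imports "HOL-Algebra.Algebra" "HOL-Algebra.Algebraic_Closure_Type"
begin

text \<open>
  A number field is a subset of an ambient field of characteristic 0 (any type of class
  \<^class>\<open>field_char_0\<close>) that is a subfield of finite dimension over the rationals.
\<close>

definition number_field :: "'a::field_char_0 set \<Rightarrow> bool" where
  "number_field K \<longleftrightarrow>
     subfield K ring_of_type_algebra \<and> ring.finite_dimension ring_of_type_algebra \<rat> K"

definition ring_of_integers :: "'a::field_char_0 set \<Rightarrow> 'a ring" where
  "ring_of_integers K = ring_of_type_algebra\<lparr>carrier := {x \<in> K. algebraic_int x}\<rparr>"

definition exact_covering_system ::
    "('a, 'b) ring_scheme \<Rightarrow> nat \<Rightarrow> (nat \<Rightarrow> 'a) \<Rightarrow> (nat \<Rightarrow> 'a set) \<Rightarrow> bool" where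
  "exact_covering_system R k \<alpha> I \<longleftrightarrow>
     (\<forall>i\<in>{1..k}. \<alpha> i \<in> carrier R \<and> ideal (I i) R \<and> I i \<noteq> {\<zero>\<^bsub>R\<^esub>} \<and> I i \<noteq> carrier R) \<and>
     (\<forall>x\<in>carrier R. \<exists>!i. i \<in> {1..k} \<and> x \<in> \<alpha> i <+\<^bsub>R\<^esub> I i)"

text \<open>
  The quotient of nonzero ideals \<open>A \<subseteq> B\<close>. Over a ring of integers the described ideal exists
  and is unique; outside that situation the value is unspecified.
\<close>

definition ideal_quotient :: "('a, 'b) ring_scheme \<Rightarrow> 'a set \<Rightarrow> 'a set \<Rightarrow> 'a set" where
  "ideal_quotient R A B = (THE C. ideal C R \<and> ideal_prod R B C = A)"

definition ideal_norm :: "('a, 'b) ring_scheme \<Rightarrow> 'a set \<Rightarrow> nat" where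
  "ideal_norm R I = card (carrier (R Quot I))"

text \<open>
  The function \<open>G\<close>. Powers and divisibility are those of the multiplicative monoid of ideals,
  so the zeroth power of an ideal is the whole ring. The library counts the zero ideal of
  a domain as prime, hence the explicit exclusion.
\<close>

definition max_prime_power_norm :: "('a, 'b) ring_scheme \<Rightarrow> 'a set \<Rightarrow> nat" where
  "max_prime_power_norm R I =
     Max {ideal_norm R (P [^]\<^bsub>ideals_set R\<^esub> r) | P (r::nat).
            primeideal P R \<and> P \<noteq> {\<zero>\<^bsub>R\<^esub>} \<and> (P [^]\<^bsub>ideals_set R\<^esub> r) divides\<^bsub>ideals_set R\<^esub> I}"

end

theory Submission
  imports Defs "Jordan_Normal_Form.Char_Poly"
begin

text \<open>
  Put \<open>A = I i\<close> and let \<open>T\<close> be the set of indices \<open>t\<close> with \<open>I t = A\<close>. The indicator function of the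
  union of the classes indexed by \<open>T\<close> is \<open>A\<close>-periodic, so it equals one minus the sum over \<open>j \<notin> T\<close> of
  the indicator functions of the other classes averaged over \<open>A\<close>, and the \<open>j\<close>-th average is periodic
  under \<open>A + I j\<close>. Choose for each such \<open>j\<close> a prime power \<open>P\<^sup>r\<close> of maximal norm dividing \<open>A / (A + I j)\<close>
  and, for each prime \<open>P\<close> occurring, the smallest exponent \<open>r\<close>; then \<open>E\<^sub>P = A / P\<^sup>r\<close> is contained in the
  corresponding \<open>A + I j\<close>. If \<open>T\<close> had fewer elements than every one of these norms, there would be
  \<open>h\<^sub>P \<in> E\<^sub>P\<close> such that no nonempty sum of distinct \<open>h\<^sub>P\<close> moves \<open>\<alpha> i\<close> into a class indexed by \<open>T\<close>. The
  alternating sum of the indicator function over all \<open>\<alpha> i + \<Sum> h\<^sub>P\<close> would then be \<open>1\<close>, whereas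
  it vanishes on each periodic summand.

  What this needs about rings of integers is that nonzero ideals are invertible and of finite index.
  An ideal \<open>(a, b)\<close> is inverted by means of a primitive integer relation between the powers
  of \<open>a / b\<close>.
\<close>

section \<open>Algebraic integers and finitely generated modules over the integers\<close>

interpretation int_mod: Modules.module "\<lambda>(n::int) (x::'a::field_char_0). of_int n * x"
  by unfold_locales (auto simp: algebra_simps)

text \<open>The determinant trick: multiplication by \<open>z\<close> acts on the generators
  \<open>V\<close> through an integer matrix \<open>W\<close>, for which the vector of generators is
  an eigenvector with eigenvalue \<open>z\<close>. So \<open>z\<close> is a root of the monic
  integer polynomial \<open>char_poly W\<close>. The generators may be dependent; \<open>v0\<close>
  only ensures that the eigenvector is not zero.\<close>

lemma algebraic_int_if_stabilises_finite_span:
  fixes z :: "'a::field_char_0"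
  assumes V: "finite V" "v0 \<in> V" "v0 \<noteq> 0"
    and st: "\<And>v. v \<in> V \<Longrightarrow> z * v \<in> int_mod.span V"
  shows "algebraic_int z"
proof -
  obtain vs where vs: "set vs = V" "distinct vs"
    using finite_distinct_list[OF V(1)] by blast
  let ?n = "length vs"
  have "\<exists>c. z * v = (\<Sum>u\<in>V. of_int (c u) * u)" if "v \<in> V" for v
    using st[OF that] int_mod.span_finite[OF V(1)] by auto
  then obtain c where c: "\<And>v. v \<in> V \<Longrightarrow> z * v = (\<Sum>u\<in>V. of_int (c v u) * u)"
    by metis
  define W :: "int mat" where "W = mat ?n ?n (\<lambda>(i,j). c (vs ! i) (vs ! j))"
  define A :: "'a mat" where "A = map_mat of_int W"
  have A: "A \<in> carrier_mat ?n ?n" "W \<in> carrier_mat ?n ?n"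
    by (auto simp: A_def W_def)
  have "A *\<^sub>v vec_of_list vs = z \<cdot>\<^sub>v vec_of_list vs"
  proof (rule eq_vecI)
    fix i assume "i < dim_vec (z \<cdot>\<^sub>v vec_of_list vs)"
    then have i: "i < ?n" by simp
    have "(A *\<^sub>v vec_of_list vs) $ i = (\<Sum>j<?n. of_int (c (vs ! i) (vs ! j)) * vs ! j)"
      using i by (simp add: A_def W_def scalar_prod_def atLeast0LessThan vec_of_list_index)
    also have "\<dots> = (\<Sum>u\<in>V. of_int (c (vs ! i) u) * u)"
      using sum.reindex_bij_betw[OF bij_betw_nth[OF vs(2) refl vs(1)[symmetric]], of "\<lambda>u. of_int (c (vs ! i) u) * u"] by simp
    also have "\<dots> = z * vs ! i"
      using c[of "vs ! i"] vs(1) i by auto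
    finally show "(A *\<^sub>v vec_of_list vs) $ i = (z \<cdot>\<^sub>v vec_of_list vs) $ i"
      using i by (simp add: vec_of_list_index)
  qed (use A in auto)
  moreover have "vec_of_list vs \<noteq> 0\<^sub>v ?n"
  proof
    assume *: "vec_of_list vs = 0\<^sub>v ?n"
    obtain i where "i < ?n" "vs ! i = v0" using V(2) vs(1) by (auto simp: in_set_conv_nth)
    with arg_cong[OF *, of "\<lambda>w. vec_index w i"] V(3) show False by (simp add: vec_of_list_index)
  qed
  ultimately have "eigenvalue A z"
    unfolding eigenvalue_def eigenvector_def carrier_matD(1)[OF A(1)]
    by (metis carrier_vec_dim_vec dim_vec_of_list)
  then have "poly (char_poly A) z = 0"
    using eigenvalue_root_char_poly[OF A(1)] by simp
  then have "poly (map_poly of_int (char_poly W)) z = 0"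
    by (simp add: A_def of_int_hom.char_poly_hom[OF A(2)])
  moreover have "lead_coeff (char_poly W) = 1"
    using degree_monic_char_poly[OF A(2)] by simp
  ultimately show ?thesis
    unfolding algebraic_int_altdef_ipoly by blast
qed

lemma algebraic_int_power_mem_span:
  fixes x :: "'a::field_char_0"
  assumes "algebraic_int x"
  obtains n where "n > 0" "x ^ n \<in> int_mod.span ((\<lambda>i. x ^ i) ` {..<n})"
proof -
  obtain p :: "int poly" where p: "poly (map_poly of_int p) x = 0" "lead_coeff p = 1"
    using assms unfolding algebraic_int_altdef_ipoly by blast
  let ?n = "degree p"
  have "poly (map_poly of_int p) x = (\<Sum>i\<le>?n. of_int (coeff p i) * x ^ i)"
    by (simp add: poly_altdef coeff_map_poly)
  also have "\<dots> = (\<Sum>i<?n. of_int (coeff p i) * x ^ i) + x ^ ?n"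
    using p(2) by (simp add: lessThan_Suc_atMost[symmetric])
  finally have eq: "x ^ ?n = (\<Sum>i<?n. of_int (- coeff p i) * x ^ i)"
    using p(1) by (simp add: sum_negf eq_neg_iff_add_eq_0 add.commute)
  \<comment> \<open>In degree 0 the relation would read \<open>1 = 0\<close>.\<close>
  have "?n > 0"
  proof (rule ccontr)
    assume "\<not> ?n > 0"
    with eq show False by simp
  qed
  moreover have "x ^ ?n \<in> int_mod.span ((\<lambda>i. x ^ i) ` {..<?n})"
    unfolding eq by (intro int_mod.span_sum int_mod.span_scale int_mod.span_base) auto
  ultimately show ?thesis using that by blast
qed

text \<open>The monomials \<open>x ^ i * y ^ j\<close> with \<open>i < m\<close> and
  \<open>j < n\<close> span a module that is stable under multiplication by \<open>x\<close> and by
  \<open>y\<close>, because \<open>x ^ m\<close> and \<open>y ^ n\<close> reduce to lower powers. It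
  is then stable under \<open>x + y\<close> and \<open>x * y\<close> as well.\<close>

lemma algebraic_int_add_times:
  fixes x y :: "'a::field_char_0"
  assumes "algebraic_int x" "algebraic_int y"
  shows "algebraic_int (x + y)" "algebraic_int (x * y)"
proof -
  obtain m where m: "m > 0" "x ^ m \<in> int_mod.span ((\<lambda>i. x ^ i) ` {..<m})"
    using algebraic_int_power_mem_span[OF assms(1)] by blast
  obtain n where n: "n > 0" "y ^ n \<in> int_mod.span ((\<lambda>i. y ^ i) ` {..<n})"
    using algebraic_int_power_mem_span[OF assms(2)] by blast
  define V where "V = (\<lambda>(i,j). x ^ i * y ^ j) ` ({..<m} \<times> {..<n})"
  have V: "finite V" "1 \<in> V"
    using m(1) n(1) by (auto simp: V_def intro!: image_eqI[of _ _ "(0,0)"])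
  have VI: "x ^ i * y ^ j \<in> V" if "i < m" "j < n" for i j
    using that by (auto simp: V_def)
  \<comment> \<open>Multiplication by \<open>t\<close> is additive, so it suffices to know where it
    sends the generators \<open>S\<close>.\<close>
  have lin: "t * u \<in> int_mod.span V" if "u \<in> int_mod.span S" "\<And>s. s \<in> S \<Longrightarrow> t * s \<in> int_mod.span V" for t u S
    using that(1)
  proof (induction rule: int_mod.span_induct_alt)
    case base show ?case by (simp add: int_mod.span_zero)
  next
    case (step c s u)
    have "t * (of_int c * s + u) = of_int c * (t * s) + t * u" by (simp add: algebra_simps)
    also have "\<dots> \<in> int_mod.span V"
      by (intro int_mod.span_add int_mod.span_scale that(2) step)
    finally show ?case .
  qed
  have xV: "x * v \<in> int_mod.span V" if "v \<in> V" for v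
  proof -
    obtain i j where ij: "i < m" "j < n" "v = x ^ i * y ^ j" using \<open>v \<in> V\<close> by (auto simp: V_def)
    show ?thesis
    proof (cases "Suc i < m")
      case True
      then have "x * v \<in> V" using VI[of "Suc i" j] ij by (simp add: mult_ac)
      then show ?thesis by (rule int_mod.span_base)
    next
      case False
      then have "m = Suc i" using ij by simp
      then have "x * v = y ^ j * x ^ m" using ij by (simp add: mult_ac)
      also have "\<dots> \<in> int_mod.span V"
        using VI ij by (intro lin[OF m(2)]) (auto simp: mult.commute[of "y ^ j"] intro!: int_mod.span_base)
      finally show ?thesis .
    qed
  qed
  have yV: "y * v \<in> int_mod.span V" if "v \<in> V" for v
  proof -
    obtain i j where ij: "i < m" "j < n" "v = x ^ i * y ^ j" using \<open>v \<in> V\<close> by (auto simp: V_def)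
    show ?thesis
    proof (cases "Suc j < n")
      case True
      then have "y * v \<in> V" using VI[of i "Suc j"] ij by (simp add: mult_ac)
      then show ?thesis by (rule int_mod.span_base)
    next
      case False
      then have "n = Suc j" using ij by simp
      then have "y * v = x ^ i * y ^ n" using ij by (simp add: mult_ac)
      also have "\<dots> \<in> int_mod.span V"
        using VI ij by (intro lin[OF n(2)]) (auto intro!: int_mod.span_base)
      finally show ?thesis .
    qed
  qed
  have "(x + y) * v \<in> int_mod.span V" if "v \<in> V" for v
    unfolding distrib_right by (intro int_mod.span_add xV yV that)
  then show "algebraic_int (x + y)"
    by (intro algebraic_int_if_stabilises_finite_span[OF V]) auto
  have "(x * y) * v \<in> int_mod.span V" if "v \<in> V" for v
    unfolding mult.assoc by (intro lin[OF yV] xV that)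
  then show "algebraic_int (x * y)"
    by (intro algebraic_int_if_stabilises_finite_span[OF V]) auto
qed

section \<open>The ambient field as an algebraic structure, and its subfields\<close>

lemma ring_of_type_algebra_simps [simp]:
  "carrier (ring_of_type_algebra :: 'a::comm_ring_1 ring) = UNIV"
  "x \<oplus>\<^bsub>ring_of_type_algebra\<^esub> y = x + y" "x \<otimes>\<^bsub>ring_of_type_algebra\<^esub> y = x * y"
  "\<zero>\<^bsub>ring_of_type_algebra\<^esub> = 0" "\<one>\<^bsub>ring_of_type_algebra\<^esub> = 1"
  by (auto simp: ring_of_type_algebra_def)

lemma a_inv_ring_of_type_algebra: "\<ominus>\<^bsub>ring_of_type_algebra\<^esub> x = - (x :: 'a::comm_ring_1)"
proof -
  interpret cring "ring_of_type_algebra :: 'a ring" by (rule cring_from_type_algebra)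
  show ?thesis using minus_equality[of "- x" x] by simp
qed

lemma m_inv_ring_of_type_algebra:
  "x \<noteq> 0 \<Longrightarrow> inv\<^bsub>ring_of_type_algebra\<^esub> x = inverse (x :: 'a::field)"
proof -
  interpret cring "ring_of_type_algebra :: 'a ring" by (rule cring_from_type_algebra)
  show "x \<noteq> 0 \<Longrightarrow> ?thesis" using comm_inv_char[of x "inverse x"] by simp
qed

lemma Rats_subfield: "subfield \<rat> (ring_of_type_algebra :: 'a::field_char_0 ring)"
proof -
  interpret field "ring_of_type_algebra :: 'a ring" by (rule field_from_type_algebra)
  show ?thesis
    by (rule subfieldI', rule subringI)
      (auto simp: a_inv_ring_of_type_algebra m_inv_ring_of_type_algebra)
qed

lemma subfield_type_closed:
  fixes K :: "'a::field_char_0 set"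
  assumes "subfield K ring_of_type_algebra"
  shows "0 \<in> K" "1 \<in> K" "x \<in> K \<Longrightarrow> y \<in> K \<Longrightarrow> x + y \<in> K" "x \<in> K \<Longrightarrow> y \<in> K \<Longrightarrow> x * y \<in> K"
    "x \<in> K \<Longrightarrow> - x \<in> K" "x \<in> K \<Longrightarrow> inverse x \<in> K"
proof -
  interpret field "ring_of_type_algebra :: 'a ring" by (rule field_from_type_algebra)
  have *: "subring K (ring_of_type_algebra :: 'a ring)"
    using assms by (simp add: subfieldE(1))
  show "0 \<in> K" "1 \<in> K" "x \<in> K \<Longrightarrow> y \<in> K \<Longrightarrow> x + y \<in> K" "x \<in> K \<Longrightarrow> y \<in> K \<Longrightarrow> x * y \<in> K"
    "x \<in> K \<Longrightarrow> - x \<in> K"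
    using subringE[OF *] by (simp_all add: a_inv_ring_of_type_algebra)
  then show "x \<in> K \<Longrightarrow> inverse x \<in> K"
    using subfield_m_inv(1)[OF assms, of x] by (cases "x = 0") (auto simp: m_inv_ring_of_type_algebra)
qed

section \<open>Primitive integer relations in a number field\<close>

lemma Rats_common_denominator:
  fixes q :: "'i \<Rightarrow> 'a::field_char_0"
  assumes "finite A" "\<And>i. i \<in> A \<Longrightarrow> q i \<in> \<rat>"
  obtains N :: int where "N \<noteq> 0" "\<And>i. i \<in> A \<Longrightarrow> of_int N * q i \<in> \<int>"
proof -
  have "\<exists>N::int. N \<noteq> 0 \<and> (\<forall>i\<in>A. of_int N * q i \<in> \<int>)"
    using assms
  proof (induction rule: finite_induct)
    case empty then show ?case by (auto intro: exI[of _ 1])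
  next
    case (insert j A)
    then obtain N :: int where N: "N \<noteq> 0" "\<And>i. i \<in> A \<Longrightarrow> of_int N * q i \<in> \<int>" by auto
    have "q j \<in> \<rat>" using insert.prems by simp
    then obtain a b :: int where ab: "b > 0" "q j = of_int a / of_int b"
      by (rule Rats_cases') auto
    have "of_int (b * N) * q i \<in> \<int>" if "i \<in> Set.insert j A" for i
    proof (cases "i = j")
      case True
      then have "of_int (b * N) * q i = of_int (N * a)" using ab by simp
      then show ?thesis by (metis Ints_of_int)
    next
      case False
      then have "of_int b * (of_int N * q i) \<in> \<int>" using that by (intro Ints_mult[OF Ints_of_int N(2)]) auto
      then show ?thesis by (simp only: of_int_mult mult.assoc)
    qed
    then show ?case using N(1) ab(1) by (intro exI[of _ "b * N"]) auto
  qed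
  then show ?thesis using that by blast
qed

lemma combine_ring_of_type_algebra:
  fixes Ks Us :: "'a::field_char_0 list"
  assumes "length Ks = length Us"
  shows "ring.combine ring_of_type_algebra Ks Us = (\<Sum>i<length Us. Ks ! i * Us ! i)"
proof -
  interpret field "ring_of_type_algebra :: 'a ring" by (rule field_from_type_algebra)
  show ?thesis
    using assms by (induction Ks Us rule: list_induct2) (simp_all add: sum.lessThan_Suc_shift del: sum.lessThan_Suc)
qed

text \<open>With \<open>d\<close> the dimension of \<open>K\<close>, any \<open>d + 1\<close>
  elements are linearly dependent over the rationals. Clearing denominators and dividing by the gcd
  makes the coefficients coprime. Coprimality is what later yields both invertibility of ideals and
  finiteness modulo a prime.\<close>

lemma number_field_int_relation:
  fixes K :: "'a::field_char_0 set"
  assumes "number_field K"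
  obtains d where "\<And>x. (\<And>i. i \<le> d \<Longrightarrow> x i \<in> K) \<Longrightarrow>
    \<exists>c::nat \<Rightarrow> int. Gcd (c ` {..d}) = 1 \<and> (\<Sum>i\<le>d. of_int (c i) * x i) = 0"
proof -
  interpret F: field "ring_of_type_algebra :: 'a ring" by (rule field_from_type_algebra)
  obtain d where d: "F.dimension d \<rat> K"
    using assms by (auto simp: number_field_def F.finite_dimension_def)
  show ?thesis
  proof (rule that[of d])
    fix x :: "nat \<Rightarrow> 'a" assume x: "\<And>i. i \<le> d \<Longrightarrow> x i \<in> K"
    define Us where "Us = map x [0..<Suc d]"
    have Us: "length Us = Suc d" "set Us \<subseteq> K" "\<And>i. i \<le> d \<Longrightarrow> Us ! i = x i"
      using x by (auto simp: Us_def less_Suc_eq_le nth_append simp del: upt_Suc)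
    have "F.dependent \<rat> Us"
      using F.independent_length_le_dimension[OF Rats_subfield d, of Us] Us by auto
    then obtain Ks where Ks: "length Ks = length Us" "F.combine Ks Us = 0" "set Ks \<subseteq> \<rat>" "set Ks \<noteq> {0}"
      using F.dependent_imp_non_trivial_combine[OF Rats_subfield, of Us] by auto
    have "Ks ! i \<in> \<rat>" if "i \<in> {..d}" for i
      using Ks(1,3) Us(1) that by (auto intro!: subsetD[OF Ks(3)])
    then obtain N :: int where N: "N \<noteq> 0" "\<And>i. i \<in> {..d} \<Longrightarrow> of_int N * Ks ! i \<in> \<int>"
      using Rats_common_denominator[of "{..d}" "\<lambda>i. Ks ! i"] by blast
    have "\<exists>a. of_int N * Ks ! i = of_int a" if "i \<le> d" for i
      using N(2)[of i] that by (auto elim: Ints_cases)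
    then obtain a where a: "\<And>i. i \<le> d \<Longrightarrow> of_int N * Ks ! i = of_int (a i)" by metis
    obtain k where k: "k \<le> d" "a k \<noteq> 0"
    proof -
      \<comment> \<open>\<open>set Ks \<noteq> {0}\<close> would also hold for an empty list, so
        nonemptiness is needed to extract a nonzero coefficient.\<close>
      have "set Ks \<noteq> {}" using Ks(1) Us(1) by auto
      then have "\<not> set Ks \<subseteq> {0}" using Ks(4) by (auto simp: subset_singleton_iff)
      then obtain q where "q \<in> set Ks" "q \<noteq> 0" by blast
      then obtain k where "k < length Ks" "Ks ! k \<noteq> 0" by (auto simp: in_set_conv_nth)
      then show ?thesis using that[of k] Ks(1) Us(1) a[of k] N(1) by (cases "a k = 0") auto
    qed
    define g where "g = Gcd (a ` {..d})"
    have g: "g \<noteq> 0" using k by (auto simp: g_def Gcd_0_iff)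
    have gd: "g dvd a i" if "i \<le> d" for i using that by (auto simp: g_def intro: Gcd_dvd)
    define c where "c i = a i div g" for i
    have ac: "a i = g * c i" if "i \<le> d" for i using gd[OF that] by (simp add: c_def)
    have "g = Gcd ((*) g ` c ` {..d})"
      unfolding g_def[symmetric] image_image using ac by (subst g_def) (intro arg_cong[of _ _ Gcd] image_cong; auto)
    also have "\<dots> = normalize (g * Gcd (c ` {..d}))"
      by (rule Gcd_mult)
    also have "\<dots> = g * Gcd (c ` {..d})"
      by (simp add: normalize_mult g_def)
    finally have 1: "Gcd (c ` {..d}) = 1" using g by simp
    have "0 = of_int N * (\<Sum>i\<le>d. Ks ! i * x i)"
      using Ks(2) combine_ring_of_type_algebra[OF Ks(1)] Us by (simp add: lessThan_Suc_atMost)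
    also have "\<dots> = (\<Sum>i\<le>d. of_int g * (of_int (c i) * x i))"
      unfolding sum_distrib_left by (intro sum.cong refl) (use a ac in \<open>auto simp: mult.assoc[symmetric]\<close>)
    also have "\<dots> = of_int g * (\<Sum>i\<le>d. of_int (c i) * x i)"
      by (simp add: sum_distrib_left)
    finally show "\<exists>c::nat \<Rightarrow> int. Gcd (c ` {..d}) = 1 \<and> (\<Sum>i\<le>d. of_int (c i) * x i) = 0"
      using 1 g by auto
  qed
qed

text \<open>Bezout's identity, applied to one element at a time; \<open>0 \<in> H\<close> covers the
  empty set, whose \<open>Gcd\<close> is 0.\<close>

lemma Gcd_mem_if_subgroup:
  fixes A :: "int set"
  assumes "finite A" "A \<subseteq> H" "0 \<in> H" "\<And>x y m n. x \<in> H \<Longrightarrow> y \<in> H \<Longrightarrow> m * x + n * y \<in> H"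
  shows "Gcd A \<in> H"
  using assms(1,2)
proof (induction rule: finite_induct)
  case (insert a A)
  then show ?case using assms(4)[of a "Gcd A"] bezout_int[of a "Gcd A"] by (metis Gcd_insert insert_subset)
qed (use assms in auto)

section \<open>Ideals of a subring of the ambient field\<close>

locale type_subring =
  fixes S :: "'a::field_char_0 set"
  assumes zero_mem: "0 \<in> S" and one_mem: "1 \<in> S"
    and add_mem: "x \<in> S \<Longrightarrow> y \<in> S \<Longrightarrow> x + y \<in> S"
    and minus_mem: "x \<in> S \<Longrightarrow> - x \<in> S"
    and mult_mem: "x \<in> S \<Longrightarrow> y \<in> S \<Longrightarrow> x * y \<in> S"
begin

abbreviation R :: "'a ring" where "R \<equiv> ring_of_type_algebra\<lparr>carrier := S\<rparr>"

abbreviation iprod :: "'a set \<Rightarrow> 'a set \<Rightarrow> 'a set" (infixl \<open>\<star>\<close> 80)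
  where "A \<star> B \<equiv> ideal_prod R A B"

lemma diff_mem: "x \<in> S \<Longrightarrow> y \<in> S \<Longrightarrow> x - y \<in> S"
  using add_mem[of x "- y"] minus_mem[of y] by simp

lemma power_mem: "x \<in> S \<Longrightarrow> x ^ (n::nat) \<in> S"
  by (induction n) (auto intro: one_mem mult_mem)

lemma sum_mem: "(\<And>x. x \<in> A \<Longrightarrow> f x \<in> S) \<Longrightarrow> sum f A \<in> S"
  by (induction A rule: infinite_finite_induct) (auto intro: zero_mem add_mem)

lemma of_int_mem: "of_int n \<in> S"
proof -
  have "of_nat m \<in> S" for m by (induction m) (auto intro: zero_mem one_mem add_mem)
  then show ?thesis using minus_mem by (cases n) (auto simp del: of_nat_Suc)
qed

lemma cring_R: "cring R"
proof -
  interpret F: field "ring_of_type_algebra :: 'a ring" by (rule field_from_type_algebra)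
  have "subring S (ring_of_type_algebra :: 'a ring)"
    by (rule F.subringI)
      (auto simp: a_inv_ring_of_type_algebra intro: one_mem add_mem minus_mem mult_mem)
  then show ?thesis
    using F.subcring_iff[of S] F.subcringI'[of S] by auto
qed

sublocale R: cring R by (rule cring_R)

lemma R_sel: "x \<oplus>\<^bsub>R\<^esub> y = x + y" "x \<otimes>\<^bsub>R\<^esub> y = x * y" "\<zero>\<^bsub>R\<^esub> = 0" "\<one>\<^bsub>R\<^esub> = 1" "carrier R = S"
  by simp_all

lemma a_inv_R: "x \<in> S \<Longrightarrow> \<ominus>\<^bsub>R\<^esub> x = - x"
  using R.minus_equality[of "- x" x] by (simp add: minus_mem)

lemma ideal_memD:
  assumes "ideal A R"
  shows "A \<subseteq> S" "x \<in> A \<Longrightarrow> x \<in> S" "0 \<in> A" "x \<in> A \<Longrightarrow> y \<in> A \<Longrightarrow> x + y \<in> A"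
    "x \<in> S \<Longrightarrow> y \<in> A \<Longrightarrow> x * y \<in> A" "x \<in> S \<Longrightarrow> y \<in> A \<Longrightarrow> y * x \<in> A"
    "x \<in> A \<Longrightarrow> - x \<in> A" "x \<in> A \<Longrightarrow> y \<in> A \<Longrightarrow> x - y \<in> A"
proof -
  interpret ideal A R by fact
  show 1: "A \<subseteq> S" "0 \<in> A"
    using a_subset additive_subgroup.zero_closed[OF additive_subgroup_axioms] by simp_all
  then show "x \<in> A \<Longrightarrow> x \<in> S" by auto
  show 2: "x \<in> A \<Longrightarrow> y \<in> A \<Longrightarrow> x + y \<in> A" for x y
    using a_closed[of x y] by simp
  show 3: "x \<in> S \<Longrightarrow> y \<in> A \<Longrightarrow> x * y \<in> A" for x y
    using I_l_closed[of y x] by simp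
  then show "x \<in> S \<Longrightarrow> y \<in> A \<Longrightarrow> y * x \<in> A" by (simp add: mult.commute)
  show 4: "x \<in> A \<Longrightarrow> - x \<in> A" for x
    using 3[of "- 1" x] minus_mem one_mem by simp
  show "x \<in> A \<Longrightarrow> y \<in> A \<Longrightarrow> x - y \<in> A"
    using 2[of x "- y"] 4[of y] by simp
qed

lemma ideal_RI:
  assumes "A \<subseteq> S" "0 \<in> A" "\<And>x y. x \<in> A \<Longrightarrow> y \<in> A \<Longrightarrow> x + y \<in> A"
    "\<And>x y. x \<in> S \<Longrightarrow> y \<in> A \<Longrightarrow> x * y \<in> A"
  shows "ideal A R"
proof (rule idealI)
  have m: "- x \<in> A" if "x \<in> A" for x
    using assms(4)[of "- 1" x] that minus_mem one_mem by simp
  show "subgroup A (add_monoid R)"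
  proof (rule group.subgroupI)
    show "group (add_monoid R)" by (rule R.a_group)
    show "inv\<^bsub>add_monoid R\<^esub> a \<in> A" if "a \<in> A" for a
      using a_inv_R[of a] m[OF that] assms(1) that by (auto simp: a_inv_def)
  qed (use assms in auto)
  show "a \<otimes>\<^bsub>R\<^esub> x \<in> A" if "a \<in> A" "x \<in> carrier R" for a x
    using assms(4)[of x a] that by (simp add: mult.commute)
qed (use assms in \<open>auto simp: R.ring_axioms\<close>)

lemma mem_set_add_iff: "x \<in> A <+>\<^bsub>R\<^esub> B \<longleftrightarrow> (\<exists>a\<in>A. \<exists>b\<in>B. x = a + b)"
  by (auto simp: set_add_def set_mult_def)

lemma a_l_coset_eq: "a <+\<^bsub>R\<^esub> A = (+) a ` A"
  by (auto simp: a_l_coset_def l_coset_def)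

lemma ideal_set_add: "ideal A R \<Longrightarrow> ideal B R \<Longrightarrow> ideal (A <+>\<^bsub>R\<^esub> B) R"
  by (rule R.add_ideals)

lemma ideal_iprod: "ideal A R \<Longrightarrow> ideal B R \<Longrightarrow> ideal (A \<star> B) R"
  by (rule R.ideal_prod_is_ideal)

lemma iprodI: "a \<in> A \<Longrightarrow> b \<in> B \<Longrightarrow> a * b \<in> A \<star> B"
  using ideal_prod.prod[of a A b B R] by simp

lemma iprod_subset:
  assumes "ideal C R" "\<And>a b. a \<in> A \<Longrightarrow> b \<in> B \<Longrightarrow> a * b \<in> C"
  shows "A \<star> B \<subseteq> C"
proof
  fix x assume "x \<in> A \<star> B"
  then show "x \<in> C"
    by (induction rule: ideal_prod.induct) (use assms ideal_memD(4) in auto)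
qed

lemma iprod_mono: "ideal C R \<Longrightarrow> ideal D R \<Longrightarrow> A \<subseteq> C \<Longrightarrow> B \<subseteq> D \<Longrightarrow> A \<star> B \<subseteq> C \<star> D"
  by (intro iprod_subset ideal_iprod iprodI) auto

lemma iprod_le: "ideal A R \<Longrightarrow> ideal B R \<Longrightarrow> A \<star> B \<subseteq> A" "ideal A R \<Longrightarrow> ideal B R \<Longrightarrow> A \<star> B \<subseteq> B"
  using R.ideal_prod_inter[of A B] by auto

lemma iprod_commute: "ideal A R \<Longrightarrow> ideal B R \<Longrightarrow> A \<star> B = B \<star> A"
  by (rule R.ideal_prod_commute)

lemma iprod_assoc: "ideal A R \<Longrightarrow> ideal B R \<Longrightarrow> ideal C R \<Longrightarrow> A \<star> B \<star> C = A \<star> (B \<star> C)"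
  by (rule R.ideal_prod_assoc)

lemma ideal_S: "ideal S R"
  using R.oneideal by simp

lemma iprod_S: "ideal A R \<Longrightarrow> A \<star> S = A"
  using R.ideal_prod_one[of A] by simp

lemma principal_ideal: "b \<in> S \<Longrightarrow> ideal ((*) b ` S) R"
  by (rule ideal_RI)
    (auto intro: mult_mem zero_mem image_eqI[of _ _ 0] simp: distrib_left[symmetric] add_mem mult.left_commute)

lemma principal_iprod: "b \<in> S \<Longrightarrow> ideal A R \<Longrightarrow> (*) b ` S \<star> A = (*) b ` A"
proof
  assume b: "b \<in> S" and A: "ideal A R"
  note D = ideal_memD[OF A]
  have "ideal ((*) b ` A) R"
    by (rule ideal_RI)
     (auto intro: mult_mem b D image_eqI[of _ _ 0] simp: distrib_left[symmetric] mult.left_commute)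
  then show "(*) b ` S \<star> A \<subseteq> (*) b ` A"
    by (rule iprod_subset) (auto simp: mult.assoc intro: D)
  show "(*) b ` A \<subseteq> (*) b ` S \<star> A"
    using iprodI[of b "(*) b ` S" _ A] image_eqI[of b "(*) b" 1 S] one_mem by auto
qed

section \<open>Invertible ideals: cancellation and divisibility\<close>

text \<open>Invertibility without fractional ideals: \<open>A \<star> B\<close> is a nonzero
  principal ideal \<open>(b)\<close>, which says that \<open>B\<close> divided by \<open>b\<close>
  is inverse to \<open>A\<close>.\<close>

definition invertible :: "'a set \<Rightarrow> bool" where
  "invertible A \<longleftrightarrow> ideal A R \<and> (\<exists>B b. ideal B R \<and> b \<in> S \<and> b \<noteq> 0 \<and> A \<star> B = (*) b ` S)"

text \<open>Multiplying by the cofactor \<open>B\<close> turns \<open>A \<star> E\<close> into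
  \<open>b\<close> times \<open>E\<close>, and multiplication by \<open>b \<noteq> 0\<close> is
  injective.\<close>

lemma invertible_cancel_subset:
  assumes "invertible A" "ideal C R" "ideal D R" "A \<star> C \<subseteq> A \<star> D"
  shows "C \<subseteq> D"
proof -
  obtain B b where A: "ideal A R" and B: "ideal B R" "b \<in> S" "b \<noteq> 0" "A \<star> B = (*) b ` S"
    using assms(1) by (auto simp: invertible_def)
  have eq: "B \<star> (A \<star> E) = (*) b ` E" if "ideal E R" for E
    using B A that by (metis iprod_assoc iprod_commute principal_iprod)
  have "B \<star> (A \<star> C) \<subseteq> B \<star> (A \<star> D)"
    by (rule iprod_mono[OF B(1) ideal_iprod[OF A assms(3)] subset_refl assms(4)])
  then have sub: "(*) b ` C \<subseteq> (*) b ` D" unfolding eq[OF assms(2)] eq[OF assms(3)] .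
  show ?thesis
  proof
    fix c assume "c \<in> C"
    then obtain d where "d \<in> D" "b * c = b * d" using sub by blast
    with B(3) show "c \<in> D" by simp
  qed
qed

lemma invertible_cancel:
  "invertible A \<Longrightarrow> ideal C R \<Longrightarrow> ideal D R \<Longrightarrow> A \<star> C = A \<star> D \<Longrightarrow> C = D"
  using invertible_cancel_subset[of A C D] invertible_cancel_subset[of A D C] by auto

lemma invertible_iprod:
  assumes "invertible A" "invertible C"
  shows "invertible (A \<star> C)"
proof -
  obtain B b where A: "ideal A R" and B: "ideal B R" "b \<in> S" "b \<noteq> 0" "A \<star> B = (*) b ` S"
    using assms(1) by (auto simp: invertible_def)
  obtain D d where C: "ideal C R" and D: "ideal D R" "d \<in> S" "d \<noteq> 0" "C \<star> D = (*) d ` S"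
    using assms(2) by (auto simp: invertible_def)
  have "A \<star> C \<star> (B \<star> D) = A \<star> (C \<star> (B \<star> D))"
    by (intro iprod_assoc ideal_iprod A B C D)
  also have "C \<star> (B \<star> D) = B \<star> (C \<star> D)"
    using B(1) C D(1) by (metis iprod_assoc iprod_commute)
  also have "A \<star> (B \<star> (C \<star> D)) = A \<star> B \<star> (C \<star> D)"
    by (intro iprod_assoc[symmetric] ideal_iprod A B C D)
  also have "\<dots> = (*) b ` (*) d ` S"
    unfolding B(4) D(4) by (intro principal_iprod principal_ideal B D)
  also have "\<dots> = (*) (b * d) ` S" by (auto simp: image_image mult.assoc)
  finally show ?thesis
    unfolding invertible_def using A B C D ideal_iprod mult_mem
    by (intro conjI exI[of _ "B \<star> D"] exI[of _ "b * d"]) auto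
qed

lemma invertible_factor:
  assumes "ideal A R" "ideal C R" "invertible (A \<star> C)"
  shows "invertible A"
proof -
  obtain B b where B: "ideal B R" "b \<in> S" "b \<noteq> 0" "A \<star> C \<star> B = (*) b ` S"
    using assms(3) by (auto simp: invertible_def)
  then show ?thesis
    unfolding invertible_def using assms ideal_iprod iprod_assoc
    by (intro conjI exI[of _ "C \<star> B"] exI[of _ b]) auto
qed

text \<open>To contain is to divide. Since \<open>C \<star> B\<close> lies in
  \<open>A \<star> B = (b)\<close>, all its elements are divisible by \<open>b\<close>, and
  \<open>D\<close> collects the quotients. Then \<open>B\<close> cancels from
  \<open>B \<star> (A \<star> D) = B \<star> C\<close>, being invertible with cofactor
  \<open>A\<close>.\<close>

lemma invertible_divides:
  assumes "invertible A" "ideal C R" "C \<subseteq> A"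
  obtains D where "ideal D R" "A \<star> D = C"
proof -
  obtain B b where A: "ideal A R" and B: "ideal B R" "b \<in> S" "b \<noteq> 0" "A \<star> B = (*) b ` S"
    using assms(1) by (auto simp: invertible_def)
  have CB: "ideal (C \<star> B) R" by (intro ideal_iprod assms B)
  note M = ideal_memD[OF CB]
  define D where "D = {x \<in> S. b * x \<in> C \<star> B}"
  have D: "ideal D R"
    by (rule ideal_RI)
      (auto simp: D_def distrib_left mult.left_commute[of b] intro: zero_mem add_mem mult_mem M)
  have "C \<star> B \<subseteq> (*) b ` S"
    using iprod_mono[of A B C B] assms B A by auto
  then have bD: "(*) b ` D = C \<star> B" by (auto simp: D_def)
  have "B \<star> (A \<star> D) = (*) b ` D"
    using A B D by (metis iprod_assoc iprod_commute principal_iprod)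
  also have "\<dots> = B \<star> C" using bD B(1) assms(2) iprod_commute by auto
  finally have *: "B \<star> (A \<star> D) = B \<star> C" .
  have "invertible B"
    unfolding invertible_def
    by (intro conjI B exI[of _ A] exI[of _ b] A trans[OF iprod_commute B(4)])
  then have "A \<star> D = C"
    by (rule invertible_cancel[OF _ ideal_iprod[OF A D] assms(2) *])
  with D that show ?thesis by blast
qed

section \<open>Arithmetic of sums of ideals, and finitely generated ideals\<close>

lemma set_add_comm: "A <+>\<^bsub>R\<^esub> B = B <+>\<^bsub>R\<^esub> A"
  by (auto simp: mem_set_add_iff set_eq_iff) (metis add.commute)+

lemma set_add_assoc: "A <+>\<^bsub>R\<^esub> B <+>\<^bsub>R\<^esub> C = A <+>\<^bsub>R\<^esub> (B <+>\<^bsub>R\<^esub> C)"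
proof (rule Set.set_eqI)
  fix x
  have "x \<in> A <+>\<^bsub>R\<^esub> B <+>\<^bsub>R\<^esub> C \<longleftrightarrow> (\<exists>a\<in>A. \<exists>b\<in>B. \<exists>c\<in>C. x = a + b + c)"
    unfolding Bex_def mem_set_add_iff by blast
  moreover have "x \<in> A <+>\<^bsub>R\<^esub> (B <+>\<^bsub>R\<^esub> C) \<longleftrightarrow> (\<exists>a\<in>A. \<exists>b\<in>B. \<exists>c\<in>C. x = a + (b + c))"
    unfolding Bex_def mem_set_add_iff by blast
  ultimately show "x \<in> A <+>\<^bsub>R\<^esub> B <+>\<^bsub>R\<^esub> C \<longleftrightarrow> x \<in> A <+>\<^bsub>R\<^esub> (B <+>\<^bsub>R\<^esub> C)"
    by (simp add: add.assoc)
qed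

lemma set_add_left_comm: "A <+>\<^bsub>R\<^esub> (B <+>\<^bsub>R\<^esub> C) = B <+>\<^bsub>R\<^esub> (A <+>\<^bsub>R\<^esub> C)"
  by (metis set_add_assoc set_add_comm)

lemma set_add_idem: "ideal A R \<Longrightarrow> A <+>\<^bsub>R\<^esub> A = A"
  using ideal_memD(3,4)[of A] by (auto simp: mem_set_add_iff set_eq_iff) force

lemma set_add_left_idem: "ideal A R \<Longrightarrow> A <+>\<^bsub>R\<^esub> (A <+>\<^bsub>R\<^esub> B) = A <+>\<^bsub>R\<^esub> B"
  using set_add_assoc[of A A B] set_add_idem[of A] by simp

lemma iprod_left_commute:
  "ideal A R \<Longrightarrow> ideal B R \<Longrightarrow> ideal C R \<Longrightarrow> A \<star> (B \<star> C) = B \<star> (A \<star> C)"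
  by (metis iprod_assoc iprod_commute)

lemma iprod_distrib_left:
  "ideal A R \<Longrightarrow> ideal B R \<Longrightarrow> ideal C R \<Longrightarrow> A \<star> (B <+>\<^bsub>R\<^esub> C) = A \<star> B <+>\<^bsub>R\<^esub> A \<star> C"
  by (rule R.ideal_prod_distr)

lemma iprod_distrib_right:
  "ideal A R \<Longrightarrow> ideal B R \<Longrightarrow> ideal C R \<Longrightarrow> (B <+>\<^bsub>R\<^esub> C) \<star> A = B \<star> A <+>\<^bsub>R\<^esub> C \<star> A"
  using iprod_distrib_left[of A B C] iprod_commute[of "B <+>\<^bsub>R\<^esub> C" A] iprod_commute[of B A]
    iprod_commute[of C A] ideal_set_add[of B C] by metis

text \<open>With \<open>A\<close>, \<open>B\<close>, \<open>C\<close> ideals, the identity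
  \<open>(A + B)(B + C)(C + A) = (A + B + C)(AB + BC + CA)\<close> reduces invertibility of finitely
  generated ideals to that of ideals with two generators.\<close>

lemma iprod_three_sums:
  assumes "ideal A R" "ideal B R" "ideal C R"
  shows "(A <+>\<^bsub>R\<^esub> B) \<star> (B <+>\<^bsub>R\<^esub> C) \<star> (C <+>\<^bsub>R\<^esub> A)
       = (A <+>\<^bsub>R\<^esub> B <+>\<^bsub>R\<^esub> C) \<star> (A \<star> B <+>\<^bsub>R\<^esub> B \<star> C <+>\<^bsub>R\<^esub> C \<star> A)"
  by (simp only: assms ideal_iprod ideal_set_add iprod_distrib_left iprod_distrib_right iprod_assoc
     iprod_commute iprod_left_commute set_add_assoc set_add_comm set_add_left_comm
     set_add_idem set_add_left_idem)

lemma subset_set_add: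
  assumes "ideal A R" "ideal B R"
  shows "A \<subseteq> A <+>\<^bsub>R\<^esub> B" "B \<subseteq> A <+>\<^bsub>R\<^esub> B"
  using ideal_memD(3)[OF assms(1)] ideal_memD(3)[OF assms(2)]
  by (force simp: mem_set_add_iff)+

lemma invertible_three_sum:
  assumes "ideal A R" "ideal B R" "ideal C R"
    and "invertible (A <+>\<^bsub>R\<^esub> B)" "invertible (B <+>\<^bsub>R\<^esub> C)" "invertible (C <+>\<^bsub>R\<^esub> A)"
  shows "invertible (A <+>\<^bsub>R\<^esub> B <+>\<^bsub>R\<^esub> C)"
proof -
  have "invertible ((A <+>\<^bsub>R\<^esub> B <+>\<^bsub>R\<^esub> C) \<star> (A \<star> B <+>\<^bsub>R\<^esub> B \<star> C <+>\<^bsub>R\<^esub> C \<star> A))"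
    using iprod_three_sums[OF assms(1-3)] invertible_iprod assms(4-6) by metis
  then show ?thesis
    by (rule invertible_factor[rotated 2]) (intro ideal_set_add ideal_iprod assms)+
qed

lemma invertible_principal: "b \<in> S \<Longrightarrow> b \<noteq> 0 \<Longrightarrow> invertible ((*) b ` S)"
  unfolding invertible_def using principal_ideal iprod_S ideal_S by blast

primrec generated :: "'a list \<Rightarrow> 'a set" where
  "generated [] = {0}"
| "generated (x # xs) = (*) x ` S <+>\<^bsub>R\<^esub> generated xs"

lemma ideal_generated: "set xs \<subseteq> S \<Longrightarrow> ideal (generated xs) R"
proof (induction xs)
  case Nil
  show ?case using R.zeroideal by simp
next
  case (Cons x xs)
  then show ?case by (simp add: ideal_set_add principal_ideal)
qed

lemma set_subset_generated: "set xs \<subseteq> S \<Longrightarrow> set xs \<subseteq> generated xs"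
proof (induction xs)
  case (Cons x xs)
  then have "x \<in> (*) x ` S" using one_mem by (auto intro: image_eqI[of _ _ 1])
  then show ?case
    using Cons subset_set_add[OF principal_ideal[of x] ideal_generated[of xs]] by auto
qed simp

lemma generated_subset: "ideal A R \<Longrightarrow> set xs \<subseteq> A \<Longrightarrow> generated xs \<subseteq> A"
proof (induction xs)
  case (Cons x xs)
  show ?case
  proof
    fix z assume "z \<in> generated (x # xs)"
    then obtain a b where ab: "a \<in> S" "b \<in> generated xs" "z = x * a + b"
      by (auto simp: mem_set_add_iff)
    then have "b \<in> A" "x \<in> A" using Cons by auto
    then show "z \<in> A" using ab ideal_memD(4,6)[OF Cons.prems(1)] by simp
  qed
qed (simp add: ideal_memD)

text \<open>Induction on the list through \<open>invertible_three_sum\<close> for the summands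
  \<open>(b)\<close>, \<open>(a)\<close> and \<open>generated xs\<close>. The sum of the first two
  is invertible by \<open>two\<close>; the other pairs use the induction hypothesis with
  \<open>a\<close> and with \<open>b\<close> as the distinguished generator. This is why
  \<open>b\<close> varies and why \<open>a = 0\<close> is treated apart.\<close>

lemma invertible_generated:
  assumes two: "\<And>a b. a \<in> S \<Longrightarrow> b \<in> S \<Longrightarrow> b \<noteq> 0 \<Longrightarrow> invertible ((*) a ` S <+>\<^bsub>R\<^esub> (*) b ` S)"
    and "set xs \<subseteq> S" "b \<in> S" "b \<noteq> 0"
  shows "invertible ((*) b ` S <+>\<^bsub>R\<^esub> generated xs)"
  using assms(2-4)
proof (induction xs arbitrary: b)
  case Nil
  have "(*) b ` S <+>\<^bsub>R\<^esub> {0} = (*) b ` S" by (auto simp: mem_set_add_iff set_eq_iff)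
  with Nil show ?case by (simp add: invertible_principal)
next
  case (Cons a xs)
  show ?case
  proof (cases "a = 0")
    case True
    have "(*) 0 ` S = {0}" using zero_mem by auto
    then have "generated (a # xs) = generated xs"
      using True by (auto simp: mem_set_add_iff set_eq_iff)
    with Cons show ?thesis by simp
  next
    case False
    have "invertible ((*) b ` S <+>\<^bsub>R\<^esub> (*) a ` S <+>\<^bsub>R\<^esub> generated xs)"
      using Cons False two[of b a]
      by (intro invertible_three_sum principal_ideal ideal_generated)
        (auto simp: set_add_comm[of "generated xs"])
    then show ?thesis by (simp add: set_add_assoc)
  qed
qed

section \<open>Cosets and norms of ideals\<close>

lemma coset_eq_iff: "ideal A R \<Longrightarrow> (+) x ` A = (+) y ` A \<longleftrightarrow> x - y \<in> A"
proof
  assume A: "ideal A R" and eq: "(+) x ` A = (+) y ` A"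
  have "x \<in> (+) x ` A" using ideal_memD(3)[OF A] by (auto intro: image_eqI[of _ _ 0])
  then show "x - y \<in> A" using eq by auto
next
  assume A: "ideal A R" and d: "x - y \<in> A"
  have "x + a = y + (x - y + a)" "y + a = x + (a - (x - y))" for a by simp_all
  then show "(+) x ` A = (+) y ` A"
    using ideal_memD(4,8)[OF A] d by (metis (no_types, opaque_lifting) image_eqI image_subset_iff subset_antisym)
qed

lemma coset_subset_iff:
  assumes "ideal A R" "ideal B R" "A \<subseteq> B"
  shows "(+) x ` A \<subseteq> (+) y ` B \<longleftrightarrow> x - y \<in> B"
proof
  assume "(+) x ` A \<subseteq> (+) y ` B"
  then have "x + 0 \<in> (+) y ` B" using ideal_memD(3)[OF assms(1)] by blast
  then show "x - y \<in> B" by auto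
next
  assume "x - y \<in> B"
  then have "(+) x ` B = (+) y ` B" using coset_eq_iff assms by blast
  then show "(+) x ` A \<subseteq> (+) y ` B" using assms(3) by blast
qed

abbreviation cosets :: "'a set \<Rightarrow> 'a set set" where
  "cosets A \<equiv> (\<lambda>x. (+) x ` A) ` S"

lemma carrier_Quot: "carrier (R Quot A) = cosets A"
  by (auto simp: FactRing_def A_RCOSETS_def' a_r_coset_def' add.commute image_iff)

lemma ideal_norm_eq: "ideal_norm R A = card (cosets A)"
  by (simp add: ideal_norm_def carrier_Quot)

text \<open>Since \<open>(b)\<close> has finite index, finitely many elements of \<open>A\<close>
  represent all of \<open>A\<close> modulo \<open>(b)\<close>; together with \<open>b\<close> they
  generate \<open>A\<close>.\<close>

lemma invertible_if_finite_quotient: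
  assumes two: "\<And>a b. a \<in> S \<Longrightarrow> b \<in> S \<Longrightarrow> b \<noteq> 0 \<Longrightarrow> invertible ((*) a ` S <+>\<^bsub>R\<^esub> (*) b ` S)"
    and fin: "finite (cosets ((*) b ` S))"
    and A: "ideal A R" "b \<in> A" "b \<noteq> 0"
  shows "invertible A"
proof -
  note D = ideal_memD[OF A(1)]
  let ?B = "(*) b ` S"
  have B: "ideal ?B R" using D(2) A principal_ideal by blast
  have "finite ((\<lambda>x. (+) x ` ?B) ` A)"
    using finite_subset[OF image_mono[OF D(1)] fin] by simp
  then obtain F where F: "F \<subseteq> A" "finite F" "(\<lambda>x. (+) x ` ?B) ` A = (\<lambda>x. (+) x ` ?B) ` F"
    by (meson finite_subset_image subset_refl)
  obtain xs where xs: "set xs = F" using F(2) finite_list by blast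
  have g: "ideal (generated xs) R" "generated xs \<subseteq> A" "F \<subseteq> generated xs"
    using ideal_generated[of xs] generated_subset[of A xs] set_subset_generated[of xs] F(1) D(1) xs A(1) by auto
  have "A = ?B <+>\<^bsub>R\<^esub> generated xs"
  proof
    show "?B <+>\<^bsub>R\<^esub> generated xs \<subseteq> A"
    proof
      fix z assume "z \<in> ?B <+>\<^bsub>R\<^esub> generated xs"
      then obtain a g where ag: "a \<in> S" "g \<in> generated xs" "z = b * a + g"
        by (auto simp: mem_set_add_iff)
      then show "z \<in> A" using D(4,6) A(2) g(2) by auto
    qed
    show "A \<subseteq> ?B <+>\<^bsub>R\<^esub> generated xs"
    proof
      fix x assume "x \<in> A"
      then obtain f where f: "f \<in> F" "(+) x ` ?B = (+) f ` ?B" using F(3) by (metis (no_types, lifting) imageE imageI)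
      then have "x - f \<in> ?B" using coset_eq_iff[OF B] by simp
      then show "x \<in> ?B <+>\<^bsub>R\<^esub> generated xs"
        using f(1) g(3) unfolding mem_set_add_iff by (intro bexI[of _ "x - f"] bexI[of _ f]) auto
    qed
  qed
  moreover have "invertible (?B <+>\<^bsub>R\<^esub> generated xs)"
    using F(1) D xs A by (intro invertible_generated two) auto
  ultimately show ?thesis by simp
qed

end

section \<open>Ideals with two generators in the ring of integers\<close>

locale number_field_integers =
  fixes K :: "'a::field_char_0 set"
  assumes number_field: "number_field K"
begin

abbreviation OK :: "'a set" where "OK \<equiv> {x \<in> K. algebraic_int x}"

lemma K_closed:
  "0 \<in> K" "1 \<in> K" "x \<in> K \<Longrightarrow> y \<in> K \<Longrightarrow> x + y \<in> K" "x \<in> K \<Longrightarrow> y \<in> K \<Longrightarrow> x * y \<in> K"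
  "x \<in> K \<Longrightarrow> - x \<in> K" "x \<in> K \<Longrightarrow> inverse x \<in> K"
  using number_field subfield_type_closed[of K] by (auto simp: number_field_def)

sublocale type_subring OK
  by unfold_locales (auto simp: K_closed algebraic_int_add_times)

text \<open>This second instance supplies closure of \<open>K\<close> under sums, powers and integer
  multiples, used to see that the elements \<open>w s\<close> below lie in \<open>K\<close>.\<close>

sublocale K: type_subring K
  by unfold_locales (auto simp: K_closed)

text \<open>For a primitive polynomial \<open>\<Sum> c i * X ^ i\<close> vanishing at
  \<open>\<gamma> = a / b\<close>, the quotient by \<open>X - \<gamma>\<close> has the coefficients
  \<open>w 1, ..., w d\<close>. They are algebraic integers, and the ideal \<open>C\<close>
  generated by them satisfies \<open>(a, b) \<star> C = (b)\<close>.\<close>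

lemma invertible_two_generators:
  assumes a: "a \<in> OK" and b: "b \<in> OK" "b \<noteq> 0"
  shows "invertible ((*) a ` OK <+>\<^bsub>R\<^esub> (*) b ` OK)"
proof -
  define \<gamma> where "\<gamma> = a / b"
  have bg: "a = b * \<gamma>" using b by (simp add: \<gamma>_def)
  have \<gamma>: "\<gamma> \<in> K"
    unfolding \<gamma>_def divide_inverse using a b by (auto intro: K_closed)
  obtain d where d: "\<And>x. (\<And>i. i \<le> d \<Longrightarrow> x i \<in> K) \<Longrightarrow>
    \<exists>c::nat \<Rightarrow> int. Gcd (c ` {..d}) = 1 \<and> (\<Sum>i\<le>d. of_int (c i) * x i) = 0"
    using number_field_int_relation[OF number_field] by blast
  obtain c :: "nat \<Rightarrow> int" where c: "Gcd (c ` {..d}) = 1" "(\<Sum>i\<le>d. of_int (c i) * \<gamma> ^ i) = 0"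
    using d[of "\<lambda>i. \<gamma> ^ i"] K.power_mem[OF \<gamma>] by blast
  \<comment> \<open>For \<open>d = 0\<close> the relation gives \<open>c 0 = 0\<close>, so the gcd
    would be 0. Hence \<open>1\<close> is among the powers in \<open>V\<close> below.\<close>
  have "d \<noteq> 0"
    using c by (intro notI) auto
  \<comment> \<open>Tails of Horner's scheme; \<open>w_rec\<close> is its recursion.\<close>
  define w where "w s = (\<Sum>k=s..d. of_int (c k) * \<gamma> ^ (k - s))" for s
  have w_rec: "w s = of_int (c s) + \<gamma> * w (Suc s)" if "s \<le> d" for s
  proof -
    have "w s = of_int (c s) + (\<Sum>k=Suc s..d. of_int (c k) * \<gamma> ^ (k - s))"
      unfolding w_def using that by (subst sum.atLeast_Suc_atMost) auto
    also have "(\<Sum>k=Suc s..d. of_int (c k) * \<gamma> ^ (k - s)) = \<gamma> * w (Suc s)"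
      unfolding w_def sum_distrib_left
    proof (rule sum.cong)
      fix k assume "k \<in> {Suc s..d}"
      then have "k - s = Suc (k - Suc s)" by auto
      then show "of_int (c k) * \<gamma> ^ (k - s) = \<gamma> * (of_int (c k) * \<gamma> ^ (k - Suc s))" by simp
    qed simp
    finally show ?thesis .
  qed
  have w0: "w 0 = 0" using c(2) by (simp add: w_def atMost_atLeast0)
  have w_big: "w s = 0" if "s > d" for s using that by (simp add: w_def)
  define V where "V = (\<lambda>i. \<gamma> ^ i) ` {..<d}"
  have V: "\<gamma> ^ i \<in> int_mod.span V" if "i < d" for i
    using that by (intro int_mod.span_base) (auto simp: V_def)
  \<comment> \<open>Multiplication by \<open>w s\<close> preserves the module spanned by \<open>1, \<dots>, \<gamma> ^ (d - 1)\<close>: where the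
    degree would grow too large, the relation allows the use of the lower part of the sum.\<close>
  have "w s * v \<in> int_mod.span V" if v: "v \<in> V" for s v
  proof -
    obtain j where j: "j < d" "v = \<gamma> ^ j" using v by (auto simp: V_def)
    show ?thesis
    proof (cases "j < s")
      case True
      have "w s * v = (\<Sum>k=s..d. of_int (c k) * \<gamma> ^ (k - s + j))"
        unfolding w_def j sum_distrib_right by (simp only: power_add mult.assoc)
      also have "\<dots> \<in> int_mod.span V"
        using True j by (intro int_mod.span_sum int_mod.span_scale V) auto
      finally show ?thesis .
    next
      case False
      have "0 = (\<Sum>k\<le>d. of_int (c k) * \<gamma> ^ k) * \<gamma> ^ (j - s)" using c(2) by simp
      also have "\<dots> = (\<Sum>k\<le>d. of_int (c k) * \<gamma> ^ (k + j - s))"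
        unfolding sum_distrib_right using False by (intro sum.cong refl) (simp add: mult.assoc flip: power_add)
      also have "{..d} = {..<s} \<union> {s..d}" using False j by auto
      also have "(\<Sum>k\<in>{..<s} \<union> {s..d}. of_int (c k) * \<gamma> ^ (k + j - s))
          = (\<Sum>k<s. of_int (c k) * \<gamma> ^ (k + j - s)) + (\<Sum>k=s..d. of_int (c k) * \<gamma> ^ (k + j - s))"
        by (rule sum.union_disjoint) auto
      also have "(\<Sum>k=s..d. of_int (c k) * \<gamma> ^ (k + j - s)) = w s * v"
        unfolding w_def j sum_distrib_right by (intro sum.cong refl) (simp add: mult.assoc flip: power_add)
      finally have "w s * v = - (\<Sum>k<s. of_int (c k) * \<gamma> ^ (k + j - s))"
        by (simp add: eq_neg_iff_add_eq_0 add.commute)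
      also have "\<dots> \<in> int_mod.span V"
        using False j by (intro int_mod.span_neg int_mod.span_sum int_mod.span_scale V) auto
      finally show ?thesis .
    qed
  qed
  then have "algebraic_int (w s)" for s
    using \<open>d \<noteq> 0\<close>
    by (intro algebraic_int_if_stabilises_finite_span[of V 1]) (auto simp: V_def intro!: image_eqI[of _ _ 0])
  moreover have "w s \<in> K" for s
    unfolding w_def by (intro K.sum_mem K.mult_mem K.of_int_mem K.power_mem \<gamma>)
  ultimately have wO: "w s \<in> OK" for s by simp
  define C where "C = generated (map w [1..<Suc d])"
  have C: "ideal C R" unfolding C_def by (rule ideal_generated) (use wO in auto)
  \<comment> \<open>Outside the range \<open>1..d\<close> the values \<open>w s\<close> vanish, so
    membership in \<open>C\<close> holds without any condition on \<open>s\<close>.\<close>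
  have wC: "w s \<in> C" for s
  proof -
    consider "s = 0" | "s > d" | "s \<in> set [1..<Suc d]" by fastforce
    then show ?thesis
    proof cases
      case 3
      then have "w s \<in> set (map w [1..<Suc d])" by (simp del: upt_Suc)
      moreover have "set (map w [1..<Suc d]) \<subseteq> OK" using wO by (auto simp del: upt_Suc)
      ultimately show ?thesis using set_subset_generated unfolding C_def by blast
    qed (use w0 w_big ideal_memD(3)[OF C] in auto)
  qed
  let ?A = "(*) a ` OK" and ?B = "(*) b ` OK"
  have A: "ideal ?A R" and B: "ideal ?B R" using a b principal_ideal by auto
  have AB: "ideal (?A <+>\<^bsub>R\<^esub> ?B) R" by (rule ideal_set_add[OF A B])
  let ?J = "ideal_prod R (?A <+>\<^bsub>R\<^esub> ?B) C"
  have J: "ideal ?J R" by (rule ideal_iprod[OF AB C])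
  have "?J = ?B"
  proof
    \<comment> \<open>The colon ideal of \<open>(b)\<close> by \<open>a\<close>: once
      \<open>C\<close> lies in it, both \<open>a\<close> and \<open>b\<close> multiply
      \<open>C\<close> into \<open>(b)\<close>.\<close>
    define D where "D = {y \<in> OK. a * y \<in> ?B}"
    note M = ideal_memD[OF B]
    have D: "ideal D R"
    proof (rule ideal_RI)
      show "x * y \<in> D" if "x \<in> OK" "y \<in> D" for x y
        using that M(5)[of x "a * y"] mult_mem[of x y] by (simp add: D_def mult.left_commute)
      show "x + y \<in> D" if "x \<in> D" "y \<in> D" for x y
        using that M(4)[of "a * x" "a * y"] add_mem[of x y] by (simp add: D_def distrib_left)
      show "0 \<in> D" unfolding D_def using M(3) zero_mem by simp
    qed (auto simp: D_def)
    have "w s \<in> D" for s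
    proof (cases s)
      case 0 then show ?thesis using w0 D ideal_memD(3) by auto
    next
      case (Suc r)
      show ?thesis
      proof (cases "r \<le> d")
        case True
        \<comment> \<open>By the recursion, \<open>\<gamma> * w (Suc r)\<close> is
          \<open>w r - c r\<close>, which is again integral.\<close>
        have "a * w (Suc r) = b * (w r - of_int (c r))"
          using w_rec[OF True] by (simp add: bg)
        moreover have "w r - of_int (c r) \<in> OK" by (intro diff_mem wO of_int_mem)
        ultimately show ?thesis unfolding D_def using wO Suc by blast
      next
        case False
        then show ?thesis using Suc w_big[of s] D ideal_memD(3) by auto
      qed
    qed
    then have CD: "C \<subseteq> D" unfolding C_def by (intro generated_subset[OF D]) auto
    show "?J \<subseteq> ?B"
    proof (rule iprod_subset[OF B])
      fix x y assume x: "x \<in> ?A <+>\<^bsub>R\<^esub> ?B" and "y \<in> C"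
      then have y: "y \<in> OK" "a * y \<in> ?B" using CD by (auto simp: D_def)
      obtain u v where uv: "u \<in> OK" "v \<in> OK" "x = a * u + b * v"
        using x by (auto simp: mem_set_add_iff)
      have "x * y = u * (a * y) + b * (v * y)" using uv by (simp add: algebra_simps)
      moreover have "b * (v * y) \<in> ?B" using mult_mem[of v y] uv y by blast
      ultimately show "x * y \<in> ?B" using M(4)[OF M(5)[OF uv(1) y(2)]] by simp
    qed
    note N = ideal_memD[OF J]
    have 1: "a \<in> ?A <+>\<^bsub>R\<^esub> ?B" "b \<in> ?A <+>\<^bsub>R\<^esub> ?B"
      using subset_set_add[OF A B] one_mem by (auto intro!: image_eqI[of _ _ 1] dest!: subsetD)
    \<comment> \<open>The integers \<open>n\<close> with \<open>n * b\<close> in the product form a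
      subgroup. It contains every \<open>c s\<close>, since
      \<open>c s * b = b * w s - a * w (Suc s)\<close>, hence also their gcd 1.\<close>
    have "1 \<in> {n. of_int n * b \<in> ?J}"
      unfolding c(1)[symmetric]
    proof (rule Gcd_mem_if_subgroup)
      show "c ` {..d} \<subseteq> {n. of_int n * b \<in> ?J}"
      proof safe
        fix s assume "s \<le> d"
        then have "of_int (c s) * b = b * w s - a * w (Suc s)"
          using w_rec[of s] by (simp add: bg algebra_simps)
        also have "\<dots> \<in> ?J" by (intro N(8) iprodI 1 wC)
        finally show "of_int (c s) * b \<in> ?J" .
      qed
      show "m * x + n * y \<in> {n. of_int n * b \<in> ?J}"
        if "x \<in> {n. of_int n * b \<in> ?J}" "y \<in> {n. of_int n * b \<in> ?J}" for x y m n
      proof -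
        have "of_int (m * x + n * y) * b = of_int m * (of_int x * b) + of_int n * (of_int y * b)"
          by (simp add: algebra_simps)
        also have "\<dots> \<in> ?J"
          using that N(4)[OF N(5)[OF of_int_mem[of m]] N(5)[OF of_int_mem[of n]]] by blast
        finally show ?thesis by simp
      qed
    qed (use N(3) in auto)
    then have "b \<in> ?J" by simp
    then show "?B \<subseteq> ?J" using N(6) by auto
  qed
  then show ?thesis
    unfolding invertible_def using AB C b by blast
qed

section \<open>Finiteness of the quotients by nonzero ideals\<close>

definition finite_mod :: "int \<Rightarrow> bool" where
  "finite_mod n \<longleftrightarrow> (\<exists>F. finite F \<and> (\<forall>x\<in>OK. \<exists>f\<in>F. \<exists>y\<in>OK. x = f + of_int n * y))"

text \<open>A maximal system of elements that are linearly independent modulo \<open>p\<close> has at most as many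
  members as the degree of \<open>K\<close>, because every relation over the integers can be made primitive.\<close>

lemma finite_mod_prime:
  assumes p: "Factorial_Ring.prime p"
  shows "finite_mod p"
proof -
  obtain d where d: "\<And>x. (\<And>i. i \<le> d \<Longrightarrow> x i \<in> K) \<Longrightarrow>
    \<exists>c::nat \<Rightarrow> int. Gcd (c ` {..d}) = 1 \<and> (\<Sum>i\<le>d. of_int (c i) * x i) = 0"
    using number_field_int_relation[OF number_field] by blast
  define indep where "indep k e \<longleftrightarrow> (\<forall>i<k. e i \<in> OK) \<and>
    (\<forall>c::nat \<Rightarrow> int. (\<Sum>i<k. of_int (c i) * e i) \<in> (*) (of_int p) ` OK \<longrightarrow> (\<forall>i<k. p dvd c i))"
    for k :: nat and e
  have "\<not> (\<exists>e. indep (Suc d) e)"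
  proof
    assume "\<exists>e. indep (Suc d) e"
    then obtain e where e: "indep (Suc d) e" by blast
    then obtain c :: "nat \<Rightarrow> int" where c: "Gcd (c ` {..d}) = 1" "(\<Sum>i\<le>d. of_int (c i) * e i) = 0"
      using d[of e] by (auto simp: indep_def less_Suc_eq_le)
    have "(\<Sum>i<Suc d. of_int (c i) * e i) \<in> (*) (of_int p) ` OK"
      using c(2) zero_mem by (auto simp: lessThan_Suc_atMost intro!: image_eqI[of _ _ 0])
    then have "\<forall>i<Suc d. p dvd c i" using e unfolding indep_def by blast
    then have "p dvd Gcd (c ` {..d})" by (intro Gcd_greatest) auto
    with c(1) p show False by auto
  qed
  moreover have "\<exists>e. indep 0 e" by (auto simp: indep_def)
  \<comment> \<open>Independent systems exist for length 0 and not for length \<open>d + 1\<close>,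
    so some length \<open>k\<close> cannot be extended.\<close>
  ultimately have "\<exists>k. (\<exists>e. indep k e) \<and> \<not> (\<exists>e. indep (Suc k) e)"
    using nat_induct[of "\<lambda>k. \<exists>e. indep k e" "Suc d"] by blast
  then obtain k e where k: "indep k e" "\<And>e. \<not> indep (Suc k) e" by blast
  define F where "F = (\<lambda>g. \<Sum>i<k. of_int (g i) * e i) ` ({..<k} \<rightarrow>\<^sub>E {0..<p})"
  have "finite F" unfolding F_def by (intro finite_imageI finite_PiE) auto
  moreover have "\<exists>f\<in>F. \<exists>y\<in>OK. x = f + of_int p * y" if x: "x \<in> OK" for x
  proof -
    have "\<not> indep (Suc k) (e(k := x))" by (rule k)
    moreover have "\<forall>i<Suc k. (e(k := x)) i \<in> OK" using k(1) x by (auto simp: indep_def less_Suc_eq)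
    ultimately obtain c :: "nat \<Rightarrow> int" where c:
      "(\<Sum>i<Suc k. of_int (c i) * (e(k := x)) i) \<in> (*) (of_int p) ` OK" "\<not> (\<forall>i<Suc k. p dvd c i)"
      unfolding indep_def by blast
    define s where "s = (\<Sum>i<k. of_int (c i) * e i)"
    have "(\<Sum>i<Suc k. of_int (c i) * (e(k := x)) i) = s + of_int (c k) * x"
      by (simp add: s_def)
    then obtain y where y: "y \<in> OK" "s + of_int (c k) * x = of_int p * y" using c(1) by auto
    \<comment> \<open>Otherwise \<open>s\<close> itself would be divisible by \<open>p\<close>, so
      independence of \<open>e\<close> would make all coefficients divisible by
      \<open>p\<close>.\<close>
    have "\<not> p dvd c k"
    proof
      assume dv: "p dvd c k"
      then obtain q where q: "c k = p * q" by blast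
      have "s = of_int p * (y - of_int q * x)" using y q by (simp add: algebra_simps)
      moreover have "y - of_int q * x \<in> OK" by (intro diff_mem mult_mem of_int_mem x y)
      ultimately have "s \<in> (*) (of_int p) ` OK" by blast
      then have "\<forall>i<k. p dvd c i" using k(1) by (simp add: indep_def s_def)
      with dv c(2) show False by (auto simp: less_Suc_eq)
    qed
    \<comment> \<open>Thus \<open>v\<close> inverts \<open>c k\<close> modulo \<open>p\<close>, and
      \<open>x\<close> is congruent to \<open>- v * s\<close>. Reducing the coefficients
      \<open>- v * c i\<close> modulo \<open>p\<close> gives the representative \<open>?f\<close>;
      \<open>z\<close> collects the quotients.\<close>
    then have "coprime p (c k)" using p prime_imp_coprime by blast
    then obtain u v where uv: "u * p + v * c k = 1"
      using bezout_int[of p "c k"] by auto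
    define g where "g = restrict (\<lambda>i. (- v * c i) mod p) {..<k}"
    have g: "g \<in> {..<k} \<rightarrow>\<^sub>E {0..<p}"
      using prime_gt_0_int[OF p] by (auto simp: g_def)
    let ?f = "\<Sum>i<k. of_int (g i) * e i"
    define z where "z = (\<Sum>i<k. of_int ((- v * c i) div p) * e i)"
    have eO: "e i \<in> OK" if "i < k" for i using k(1) that by (auto simp: indep_def)
    have z: "z \<in> OK" unfolding z_def by (intro sum_mem mult_mem of_int_mem eO) auto
    have "?f + of_int p * z = (\<Sum>i<k. (of_int (g i) + of_int p * of_int ((- v * c i) div p)) * e i)"
      by (simp only: z_def sum_distrib_left sum.distrib[symmetric] distrib_right mult.assoc)
    also have "\<dots> = (\<Sum>i<k. of_int (- v * c i) * e i)"
    proof (intro sum.cong refl)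
      fix i assume "i \<in> {..<k}"
      then have "g i + p * ((- v * c i) div p) = - v * c i" by (simp add: g_def)
      then show "(of_int (g i) + of_int p * of_int ((- v * c i) div p)) * e i = of_int (- v * c i) * e i"
        by (metis of_int_add of_int_mult)
    qed
    also have "\<dots> = - of_int v * s"
      by (simp only: s_def sum_distrib_left mult.assoc of_int_mult of_int_minus)
    finally have f: "?f + of_int p * z = - of_int v * s" .
    have "x = of_int (u * p + v * c k) * x" using uv by simp
    also have "\<dots> = of_int v * (of_int (c k) * x) + of_int p * (of_int u * x)"
      by (simp add: algebra_simps)
    also have "of_int (c k) * x = of_int p * y - s" using y(2) by (simp add: algebra_simps)
    finally have "x = - of_int v * s + of_int p * (of_int v * y + of_int u * x)"
      by (simp add: algebra_simps)
    also have "\<dots> = ?f + of_int p * (z + (of_int v * y + of_int u * x))"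
      unfolding f[symmetric] by (simp add: algebra_simps)
    finally have "x = ?f + of_int p * (z + (of_int v * y + of_int u * x))" .
    moreover have "z + (of_int v * y + of_int u * x) \<in> OK"
      by (intro add_mem mult_mem of_int_mem x y z)
    moreover have "?f \<in> F" using g by (auto simp: F_def)
    ultimately show ?thesis by blast
  qed
  ultimately show ?thesis unfolding finite_mod_def by blast
qed

lemma finite_mod_mult:
  assumes "finite_mod m" "finite_mod n"
  shows "finite_mod (m * n)"
proof -
  obtain F where F: "finite F" "\<And>x. x \<in> OK \<Longrightarrow> \<exists>f\<in>F. \<exists>y\<in>OK. x = f + of_int m * y"
    using assms(1) unfolding finite_mod_def by blast
  obtain G where G: "finite G" "\<And>x. x \<in> OK \<Longrightarrow> \<exists>f\<in>G. \<exists>y\<in>OK. x = f + of_int n * y"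
    using assms(2) unfolding finite_mod_def by blast
  define H where "H = (\<lambda>(f, g). f + of_int m * g) ` (F \<times> G)"
  have "\<exists>h\<in>H. \<exists>z\<in>OK. x = h + of_int (m * n) * z" if "x \<in> OK" for x
  proof -
    obtain f y where fy: "f \<in> F" "y \<in> OK" "x = f + of_int m * y" using F(2) \<open>x \<in> OK\<close> by blast
    obtain g z where gz: "g \<in> G" "z \<in> OK" "y = g + of_int n * z" using G(2) fy(2) by blast
    have "x = (f + of_int m * g) + of_int (m * n) * z" using fy gz by (simp add: algebra_simps)
    moreover have "f + of_int m * g \<in> H" using fy gz by (auto simp: H_def)
    ultimately show ?thesis using gz by blast
  qed
  moreover have "finite H" using F G by (simp add: H_def)
  ultimately show ?thesis unfolding finite_mod_def by blast
qed

lemma finite_mod_nonzero: "n \<noteq> 0 \<Longrightarrow> finite_mod n"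
proof (induction n rule: prime_divisors_induct)
  case (unit n)
  \<comment> \<open>A unit is its own inverse, so every \<open>x\<close> is \<open>n\<close> times
    \<open>n * x\<close> and 0 is the only representative.\<close>
  then have n: "n * n = 1" by (auto simp: zdvd1_eq abs_if split: if_splits)
  have "\<exists>y\<in>OK. x = 0 + of_int n * y" if "x \<in> OK" for x
  proof (intro bexI[of _ "of_int n * x"])
    have "of_int n * (of_int n * x) = of_int (n * n) * x" by (simp only: of_int_mult mult.assoc)
    then show "x = 0 + of_int n * (of_int n * x)" by (simp add: n)
    show "of_int n * x \<in> OK" by (intro mult_mem of_int_mem that)
  qed
  then show ?case unfolding finite_mod_def by (intro exI[of _ "{0}"]) auto
next
  case (factor p n)
  then show ?case using finite_mod_mult finite_mod_prime by auto
qed simp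

text \<open>Cancel factors \<open>X\<close> from an integer polynomial vanishing at
  \<open>x \<noteq> 0\<close> until its constant term is nonzero; that term is then a multiple of
  \<open>x\<close>.\<close>

lemma ideal_contains_int:
  assumes A: "ideal A R" and x: "x \<in> A" "x \<noteq> 0"
  obtains n :: int where "n \<noteq> 0" "of_int n \<in> A"
proof -
  have xO: "x \<in> OK" using ideal_memD(2)[OF A x(1)] .
  have ev: "poly (map_poly of_int q) x \<in> OK" for q :: "int poly"
  proof (induction q)
    case 0
    show ?case using zero_mem by simp
  next
    case (pCons a q)
    have "of_int a + x * poly (map_poly of_int q) x \<in> OK"
      by (intro add_mem mult_mem of_int_mem xO pCons.IH)
    then show ?case by (simp add: of_int_hom.map_poly_pCons_hom)
  qed
  have "\<exists>n. n \<noteq> 0 \<and> of_int n \<in> A" if "q \<noteq> 0" "poly (map_poly of_int q) x = 0" for q :: "int poly"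
    using that
  proof (induction q)
    case (pCons a q)
    have eq: "of_int a + x * poly (map_poly of_int q) x = 0"
      using pCons.prems(2) by (simp add: of_int_hom.map_poly_pCons_hom)
    show ?case
    proof (cases "a = 0")
      case True
      then show ?thesis using pCons eq x(2) by auto
    next
      case False
      have "of_int a = - (x * poly (map_poly of_int q) x)" using eq by (simp add: eq_neg_iff_add_eq_0)
      also have "\<dots> \<in> A" using ideal_memD(6,7)[OF A] ev x by blast
      finally show ?thesis using False by blast
    qed
  qed simp
  moreover obtain q :: "int poly" where "lead_coeff q = 1" "poly (map_poly of_int q) x = 0"
    using xO unfolding algebraic_int_altdef_ipoly mem_Collect_eq by blast
  ultimately show ?thesis using that by (metis leading_coeff_0_iff zero_neq_one)
qed

text \<open>The ideal contains a nonzero integer \<open>n\<close>, and representatives modulo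
  \<open>n\<close> also represent the classes modulo \<open>A\<close>.\<close>

lemma finite_cosets:
  assumes A: "ideal A R" "A \<noteq> {0}"
  shows "finite (cosets A)"
proof -
  obtain x where "x \<in> A" "x \<noteq> 0" using A(2) ideal_memD(3)[OF A(1)] by blast
  then obtain n where n: "n \<noteq> 0" "of_int n \<in> A" using ideal_contains_int[OF A(1)] by blast
  obtain F where F: "finite F" "\<And>x. x \<in> OK \<Longrightarrow> \<exists>f\<in>F. \<exists>y\<in>OK. x = f + of_int n * y"
    using finite_mod_nonzero[OF n(1)] unfolding finite_mod_def by blast
  have "cosets A \<subseteq> (\<lambda>x. (+) x ` A) ` F"
  proof
    fix z assume "z \<in> cosets A"
    then obtain x where x: "x \<in> OK" "z = (+) x ` A" by blast
    obtain f y where fy: "f \<in> F" "y \<in> OK" "x = f + of_int n * y" using F(2)[OF x(1)] by blast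
    have "x - f \<in> A" using ideal_memD(6)[OF A(1) fy(2) n(2)] fy(3) by simp
    then have "z = (+) f ` A" using coset_eq_iff[OF A(1)] x(2) by simp
    with fy(1) show "z \<in> (\<lambda>x. (+) x ` A) ` F" by blast
  qed
  with F(1) show ?thesis by (meson finite_imageI finite_subset)
qed

lemma invertible_nonzero:
  assumes "ideal A R" "A \<noteq> {0}"
  shows "invertible A"
proof -
  obtain b where b: "b \<in> A" "b \<noteq> 0" using assms ideal_memD(3)[OF assms(1)] by blast
  then have bO: "b \<in> OK" using ideal_memD(2)[OF assms(1)] by blast
  have "b * 1 \<in> (*) b ` OK" using one_mem by blast
  then have "finite (cosets ((*) b ` OK))"
    using b(2) by (intro finite_cosets principal_ideal bO) auto
  then show ?thesis
    using invertible_if_finite_quotient invertible_two_generators assms(1) b by blast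
qed

end

section \<open>Cancellation in alternating sums over subsets\<close>

text \<open>The terms for \<open>U\<close> and \<open>insert q U\<close> have opposite signs and
  cancel. This is an iterated difference, which vanishes as soon as \<open>f\<close> is invariant in
  one direction.\<close>

lemma alternating_sum_Pow_eq_0:
  fixes f :: "'b set \<Rightarrow> int"
  assumes "finite A" "q \<in> A" "\<And>U. U \<subseteq> A - {q} \<Longrightarrow> f (insert q U) = f U"
  shows "(\<Sum>U\<in>Pow A. (- 1) ^ card U * f U) = 0"
proof -
  define B where "B = A - {q}"
  have B: "finite B" "q \<notin> B" "A = insert q B" using assms by (auto simp: B_def)
  have "(\<Sum>U\<in>Pow A. (- 1) ^ card U * f U)
      = (\<Sum>U\<in>Pow B. (- 1) ^ card U * f U) + (\<Sum>U\<in>insert q ` Pow B. (- 1) ^ card U * f U)"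
    unfolding B(3) Pow_insert using B by (intro sum.union_disjoint) auto
  also have "(\<Sum>U\<in>insert q ` Pow B. (- 1) ^ card U * f U)
      = (\<Sum>U\<in>Pow B. (- 1) ^ card (insert q U) * f (insert q U))"
    using B(2) by (subst sum.reindex) (auto simp: inj_on_def)
  also have "\<dots> = (\<Sum>U\<in>Pow B. - ((- 1) ^ card U * f U))"
  proof (intro sum.cong refl)
    fix U assume "U \<in> Pow B"
    then have "U \<subseteq> B" by simp
    then have "finite U" "q \<notin> U" "f (insert q U) = f U"
      using B(1,2) finite_subset assms(3)[of U] unfolding B_def by blast+
    then show "(- 1) ^ card (insert q U) * f (insert q U) = - ((- 1) ^ card U * f U)" by simp
  qed
  finally show ?thesis by (simp add: sum_negf)
qed

section \<open>Prime ideals, their powers and residues modulo them\<close>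

locale finite_dedekind = type_subring S for S :: "'a::field_char_0 set" +
  assumes finite_cosets: "ideal A R \<Longrightarrow> A \<noteq> {0} \<Longrightarrow> finite (cosets A)"
    and invertible_nonzero: "ideal A R \<Longrightarrow> A \<noteq> {0} \<Longrightarrow> invertible A"
begin

abbreviation ipow :: "'a set \<Rightarrow> nat \<Rightarrow> 'a set" where
  "ipow P r \<equiv> P [^]\<^bsub>ideals_set R\<^esub> r"

lemma ipow_0: "ipow P 0 = S"
  by (simp add: nat_pow_def ideals_set_def)

lemma ipow_Suc: "ipow P (Suc r) = ipow P r \<star> P"
  by (simp add: nat_pow_def ideals_set_def)

lemma ideal_ipow: "ideal P R \<Longrightarrow> ideal (ipow P r) R"
  by (induction r) (simp_all only: ipow_0 ipow_Suc ideal_S ideal_iprod)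

lemma ipow_add: "ideal P R \<Longrightarrow> ipow P (m + n) = ipow P m \<star> ipow P n"
  by (induction n) (simp_all only: ipow_0 ipow_Suc ideal_ipow iprod_S iprod_assoc add_0_right add_Suc_right)

lemma nonzero_elem:
  assumes "ideal A R" "A \<noteq> {0}"
  obtains a where "a \<in> A" "a \<noteq> 0" "a \<in> S"
  using assms ideal_memD(2,3)[OF assms(1)] by blast

lemma primeD:
  assumes "primeideal P R"
  shows "ideal P R" "1 \<notin> P" "x \<in> S \<Longrightarrow> y \<in> S \<Longrightarrow> x * y \<in> P \<Longrightarrow> x \<in> P \<or> y \<in> P"
proof -
  interpret primeideal P R by fact
  show P: "ideal P R" by (rule ideal_axioms)
  show "1 \<notin> P" using I_notcarr one_imp_carrier by auto
  show "x \<in> S \<Longrightarrow> y \<in> S \<Longrightarrow> x * y \<in> P \<Longrightarrow> x \<in> P \<or> y \<in> P"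
    using I_prime[of x y] by simp
qed

lemma prime_power_mem: "primeideal P R \<Longrightarrow> x \<in> S \<Longrightarrow> x ^ n \<in> P \<Longrightarrow> x \<in> P"
proof (induction n)
  case 0
  then show ?case using primeD(2) by simp
next
  case (Suc n)
  then show ?case using primeD(3)[of P x "x ^ n"] power_mem by auto
qed

text \<open>A finite domain is a field: two powers of \<open>x\<close> agree modulo
  \<open>P\<close>, and the common factor \<open>x ^ m\<close> cancels because it is not in
  \<open>P\<close>. The inverse is \<open>x ^ (n - m - 1)\<close>.\<close>

lemma prime_inverse_mod:
  assumes P: "primeideal P R" "P \<noteq> {0}" and x: "x \<in> S" "x \<notin> P"
  obtains y where "y \<in> S" "1 - x * y \<in> P"
proof -
  have "range (\<lambda>n::nat. (+) (x ^ n) ` P) \<subseteq> cosets P"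
    using power_mem[OF x(1)] by auto
  then have "finite (range (\<lambda>n::nat. (+) (x ^ n) ` P))"
    using finite_cosets[OF primeD(1)[OF P(1)] P(2)] finite_subset by blast
  then have "\<not> inj (\<lambda>n::nat. (+) (x ^ n) ` P)"
    using finite_imageD infinite_UNIV_nat by blast
  then obtain m n :: nat where "m \<noteq> n" "(+) (x ^ m) ` P = (+) (x ^ n) ` P"
    unfolding inj_def by blast
  then obtain m n :: nat where mn: "m < n" "(+) (x ^ m) ` P = (+) (x ^ n) ` P"
    by (metis linorder_neqE_nat)
  then have "x ^ m - x ^ n \<in> P" using coset_eq_iff primeD(1)[OF P(1)] by blast
  moreover have "x ^ m - x ^ n = x ^ m * (1 - x ^ (n - m))"
    using mn(1) by (simp add: right_diff_distrib flip: power_add)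
  ultimately have "x ^ m \<in> P \<or> 1 - x ^ (n - m) \<in> P"
    using primeD(3)[OF P(1)] power_mem[OF x(1)] diff_mem one_mem by metis
  then have "1 - x ^ (n - m) \<in> P" using prime_power_mem[OF P(1) x(1)] x(2) by blast
  moreover have "x ^ (n - m) = x * x ^ (n - m - 1)"
    using mn(1) by (cases "n - m") auto
  ultimately have "1 - x * x ^ (n - m - 1) \<in> P" by simp
  then show ?thesis using that[of "x ^ (n - m - 1)"] power_mem[OF x(1)] by blast
qed

text \<open>An ideal not contained in \<open>P\<close> is coprime to \<open>P\<close>, hence to all
  its powers. Passing from \<open>f\<close> to \<open>f + g - f * g\<close> multiplies
  \<open>1 - f\<close> by \<open>1 - g\<close> and so gains one power of \<open>P\<close>.\<close>

lemma one_minus_mem_ipow: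
  assumes P: "primeideal P R" "P \<noteq> {0}" and F: "ideal F R" "\<not> F \<subseteq> P"
  obtains f where "f \<in> F" "1 - f \<in> ipow P r"
proof -
  note D = ideal_memD[OF F(1)]
  obtain x where x: "x \<in> F" "x \<notin> P" using F(2) by blast
  then obtain y where y: "y \<in> S" "1 - x * y \<in> P"
    using prime_inverse_mod[OF P] D(2) by blast
  define g where "g = x * y"
  have g: "g \<in> F" "1 - g \<in> P" using D(6) x y by (auto simp: g_def)
  have "\<exists>f\<in>F. 1 - f \<in> ipow P r"
  proof (induction r)
    case 0
    show ?case using D(3) one_mem by (intro bexI[of _ 0]) (simp_all only: ipow_0 diff_zero)
  next
    case (Suc r)
    then obtain f where f: "f \<in> F" "1 - f \<in> ipow P r" by blast
    have "1 - (f + g - f * g) = (1 - f) * (1 - g)" by (simp add: algebra_simps)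
    also have "\<dots> \<in> ipow P (Suc r)" unfolding ipow_Suc by (intro iprodI f g)
    finally have "1 - (f + g - f * g) \<in> ipow P (Suc r)" .
    moreover have "f + g - f * g \<in> F"
      using D(8)[OF D(4)[OF f(1) g(1)] D(5)[OF D(2)[OF f(1)] g(1)]] .
    ultimately show ?case by blast
  qed
  then show ?thesis using that by blast
qed

text \<open>Multiplication by \<open>e\<close> is injective from residues modulo
  \<open>ipow P r\<close> to residues modulo \<open>E \<star> ipow P r\<close>. Indeed
  \<open>(e) = E \<star> F\<close> with \<open>F\<close> not inside \<open>P\<close>; cancelling
  \<open>E\<close> leaves \<open>(x) \<star> F\<close> inside \<open>ipow P r\<close>, and
  \<open>F\<close> is coprime to that power.\<close>

lemma mem_ipow_if_mult_mem:
  assumes P: "primeideal P R" "P \<noteq> {0}" and E: "ideal E R" "E \<noteq> {0}"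
    and e: "e \<in> E" "e \<notin> E \<star> P" and x: "x \<in> S" "x * e \<in> E \<star> ipow P r"
  shows "x \<in> ipow P r"
proof -
  note PI = primeD(1)[OF P(1)]
  have Pr: "ideal (ipow P r) R" by (rule ideal_ipow[OF PI])
  have eS: "e \<in> S" using ideal_memD(2)[OF E(1) e(1)] .
  have "(*) e ` S \<subseteq> E" using ideal_memD(6)[OF E(1) _ e(1)] by blast
  then obtain F where F: "ideal F R" "E \<star> F = (*) e ` S"
    using invertible_divides[OF invertible_nonzero[OF E] principal_ideal[OF eS]] by blast
  have "e * 1 \<in> E \<star> F" unfolding F(2) using one_mem by blast
  then have "e \<in> E \<star> F" by (simp only: mult_1_right)
  then have "\<not> F \<subseteq> P" using e(2) iprod_mono[OF E(1) PI subset_refl, of F] by blast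
  then obtain f where f: "f \<in> F" "1 - f \<in> ipow P r" using one_minus_mem_ipow[OF P F(1)] by blast
  have xS: "ideal ((*) x ` S) R" by (rule principal_ideal[OF x(1)])
  have "E \<star> ((*) x ` S \<star> F) = (*) x ` S \<star> (E \<star> F)"
    by (rule iprod_left_commute[OF E(1) xS F(1)])
  also have "\<dots> = (*) x ` (*) e ` S"
    unfolding F(2) by (rule principal_iprod[OF x(1) principal_ideal[OF eS]])
  also have "\<dots> \<subseteq> E \<star> ipow P r"
    using ideal_memD(6)[OF ideal_iprod[OF E(1) Pr] _ x(2)] by (auto simp flip: mult.assoc)
  finally have "(*) x ` S \<star> F \<subseteq> ipow P r"
    by (rule invertible_cancel_subset[OF invertible_nonzero[OF E] ideal_iprod[OF xS F(1)] Pr])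
  moreover have "x \<in> (*) x ` S" using one_mem by (auto intro: image_eqI[of _ _ 1])
  ultimately have "x * f \<in> ipow P r" using iprodI f(1) by blast
  moreover have "x * (1 - f) \<in> ipow P r" by (rule ideal_memD(5)[OF Pr x(1) f(2)])
  ultimately have "x * f + x * (1 - f) \<in> ipow P r" by (rule ideal_memD(4)[OF Pr])
  then show ?thesis by (simp add: algebra_simps)
qed

text \<open>The multiples \<open>x * e\<close> of a suitable \<open>e \<in> E\<close> meet at least
  as many classes modulo \<open>E \<star> ipow P r\<close> as \<open>ipow P r\<close> has cosets, so
  fewer elements \<open>t\<close> cannot account for all of them.\<close>

lemma avoid_cosets:
  assumes P: "primeideal P R" "P \<noteq> {0}" and E: "ideal E R" "E \<noteq> {0}"
    and T: "finite T" "card T < card (cosets (ipow P r))"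
  obtains h where "h \<in> E" "\<And>t. t \<in> T \<Longrightarrow> h - t \<notin> E \<star> ipow P r"
proof -
  note PI = primeD(1)[OF P(1)]
  have Pr: "ideal (ipow P r) R" by (rule ideal_ipow[OF PI])
  have EP: "ideal (E \<star> ipow P r) R" by (rule ideal_iprod[OF E(1) Pr])
  \<comment> \<open>Cancelling \<open>E\<close> would put 1 into \<open>P\<close>.\<close>
  have "\<not> E \<subseteq> E \<star> P"
  proof
    assume "E \<subseteq> E \<star> P"
    then have "E \<star> S \<subseteq> E \<star> P" by (simp add: iprod_S[OF E(1)])
    then have "S \<subseteq> P" by (rule invertible_cancel_subset[OF invertible_nonzero[OF E] ideal_S PI])
    then show False using one_mem primeD(2)[OF P(1)] by blast
  qed
  then obtain e where e: "e \<in> E" "e \<notin> E \<star> P" by blast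
  have "\<exists>h\<in>E. \<forall>t\<in>T. h - t \<notin> E \<star> ipow P r"
  proof (rule ccontr)
    assume "\<not> ?thesis"
    moreover have "x * e \<in> E" if "x \<in> S" for x using ideal_memD(5)[OF E(1) that e(1)] .
    ultimately have "\<exists>t\<in>T. x * e - t \<in> E \<star> ipow P r" if "x \<in> S" for x
      using that by blast
    then obtain \<tau> where \<tau>: "\<And>x. x \<in> S \<Longrightarrow> \<tau> x \<in> T" "\<And>x. x \<in> S \<Longrightarrow> x * e - \<tau> x \<in> E \<star> ipow P r"
      by metis
    \<comment> \<open>If \<open>\<tau> x = \<tau> y\<close>, then \<open>(x - y) * e\<close> lies in
      \<open>E \<star> ipow P r\<close>, so \<open>x\<close> and \<open>y\<close> share a coset.
      Hence \<open>\<tau> x\<close> determines the coset of \<open>x\<close>, recovered here from a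
      chosen preimage.\<close>
    have "cosets (ipow P r) \<subseteq> (\<lambda>t. (+) (SOME x. x \<in> S \<and> \<tau> x = t) ` ipow P r) ` T"
    proof safe
      fix x assume x: "x \<in> S"
      define y where "y = (SOME y. y \<in> S \<and> \<tau> y = \<tau> x)"
      have y: "y \<in> S" "\<tau> y = \<tau> x" using someI[of "\<lambda>y. y \<in> S \<and> \<tau> y = \<tau> x" x] x by (auto simp: y_def)
      have "(x * e - \<tau> x) - (y * e - \<tau> y) \<in> E \<star> ipow P r"
        by (intro ideal_memD(8)[OF EP] \<tau> x y)
      then have "(x - y) * e \<in> E \<star> ipow P r" using y(2) by (simp add: algebra_simps)
      then have "x - y \<in> ipow P r" by (intro mem_ipow_if_mult_mem[OF P E e] diff_mem x y)
      then have "(+) x ` ipow P r = (+) y ` ipow P r" using coset_eq_iff[OF Pr] by blast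
      then show "(+) x ` ipow P r \<in> (\<lambda>t. (+) (SOME x. x \<in> S \<and> \<tau> x = t) ` ipow P r) ` T"
        using \<tau>(1)[OF x] unfolding y_def by blast
    qed
    then have "card (cosets (ipow P r)) \<le> card T" by (rule surj_card_le[OF T(1)])
    with T(2) show False by simp
  qed
  then show ?thesis using that by blast
qed

text \<open>Nonzero primes are maximal: if \<open>Q \<subseteq> P\<close>, an element of
  \<open>P\<close> outside \<open>Q\<close> is invertible modulo \<open>Q\<close>, which forces
  \<open>1 \<in> P\<close>. Primality of \<open>P\<close> extends this to powers of
  \<open>Q\<close>.\<close>

lemma prime_not_subset:
  assumes P: "primeideal P R" and Q: "primeideal Q R" "Q \<noteq> {0}" and "P \<noteq> Q"
  shows "\<not> ipow Q n \<subseteq> P"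
proof (induction n)
  case 0
  show ?case using primeD(2)[OF P] one_mem unfolding ipow_0 by blast
next
  case (Suc n)
  have "\<not> Q \<subseteq> P"
  proof
    assume sub: "Q \<subseteq> P"
    then obtain x where x: "x \<in> P" "x \<notin> Q" using \<open>P \<noteq> Q\<close> by blast
    note D = ideal_memD[OF primeD(1)[OF P]]
    obtain y where "y \<in> S" "1 - x * y \<in> Q" using prime_inverse_mod[OF Q _ x(2)] D(2) x(1) by blast
    then have "1 - x * y + x * y \<in> P" using sub x by (intro D(4) D(6)) auto
    then show False using primeD(2)[OF P] by simp
  qed
  then show ?case
    using R.primeideal_divides_ideal_prod[OF P ideal_ipow[OF primeD(1)[OF Q(1)], of n] primeD(1)[OF Q(1)]] Suc
    unfolding ipow_Suc by blast
qed

text \<open>Chinese remainder theorem: for each \<open>Q\<close> take an element of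
  \<open>ipow Q (s Q)\<close> congruent to 1 modulo \<open>ipow P r\<close>, and multiply them
  all.\<close>

lemma crt_idempotent:
  assumes P: "primeideal P R" "P \<noteq> {0}"
    and F: "finite F" "\<And>Q. Q \<in> F \<Longrightarrow> primeideal Q R \<and> Q \<noteq> {0} \<and> Q \<noteq> P"
  obtains u where "u \<in> S" "1 - u \<in> ipow P r" "\<And>Q. Q \<in> F \<Longrightarrow> u \<in> ipow Q (s Q)"
proof -
  note Pr = ideal_memD[OF ideal_ipow[OF primeD(1)[OF P(1)], of r]]
  have "\<exists>u\<in>S. 1 - u \<in> ipow P r \<and> (\<forall>Q\<in>F. u \<in> ipow Q (s Q))"
    using F
  proof (induction rule: finite_induct)
    case empty
    show ?case using one_mem Pr(3) by (intro bexI[of _ 1]) auto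
  next
    case (insert Q F)
    then obtain u where u: "u \<in> S" "1 - u \<in> ipow P r" "\<And>Q. Q \<in> F \<Longrightarrow> u \<in> ipow Q (s Q)" by auto
    have Q: "primeideal Q R" "Q \<noteq> {0}" "P \<noteq> Q" using insert.prems by auto
    have Qi: "ideal (ipow Q (s Q)) R" by (rule ideal_ipow[OF primeD(1)[OF Q(1)]])
    obtain v where v: "v \<in> ipow Q (s Q)" "1 - v \<in> ipow P r"
      using one_minus_mem_ipow[OF P Qi prime_not_subset[OF P(1) Q]] by blast
    have vS: "v \<in> S" by (rule ideal_memD(2)[OF Qi v(1)])
    have "1 - u * v = (1 - u) + u * (1 - v)" by (simp add: algebra_simps)
    also have "\<dots> \<in> ipow P r" using Pr(4)[OF u(2) Pr(5)[OF u(1) v(2)]] .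
    finally have "1 - u * v \<in> ipow P r" .
    moreover have "u * v \<in> ipow Q' (s Q')" if "Q' \<in> insert Q F" for Q'
    proof (cases "Q' = Q")
      case True
      then show ?thesis using ideal_memD(5)[OF Qi u(1) v(1)] by simp
    next
      case False
      then have "Q' \<in> F" "primeideal Q' R" using that insert.prems by auto
      then show ?thesis using ideal_memD(6)[OF ideal_ipow[OF primeD(1)] vS u(3)] by blast
    qed
    ultimately show ?case using mult_mem[OF u(1) vS] by blast
  qed
  then show ?thesis using that by blast
qed

section \<open>The alternating-sum argument for exact covers\<close>

lemma ideal_sum_mem: "ideal A R \<Longrightarrow> (\<And>x. x \<in> F \<Longrightarrow> f x \<in> A) \<Longrightarrow> sum f F \<in> A"
  by (induction F rule: infinite_finite_induct) (auto simp: ideal_memD)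

lemma mem_coset_iff: "y \<in> (+) c ` A \<longleftrightarrow> y - c \<in> A" for y c :: 'a
  by (auto intro: image_eqI[of _ _ "y - c"])

text \<open>The core of the argument for any choice of prime powers dividing
  \<open>I i / (I i + I j)\<close>, with cofactors \<open>D j\<close>. Maximality of their norms
  enters only when the lemma is applied.\<close>

lemma covering_multiplicity:
  assumes cov: "exact_covering_system R k \<alpha> I" and i: "i \<in> {1..k}"
    and J: "J = {j \<in> {1..k}. I j \<noteq> I i}" "J \<noteq> {}"
    and P: "\<And>j. j \<in> J \<Longrightarrow> primeideal (P j) R" "\<And>j. j \<in> J \<Longrightarrow> P j \<noteq> {0}"
    and D: "\<And>j. j \<in> J \<Longrightarrow> ideal (D j) R"
      "\<And>j. j \<in> J \<Longrightarrow> (I i <+>\<^bsub>R\<^esub> I j) \<star> D j \<star> ipow (P j) (r j) = I i"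
    and m: "\<And>j. j \<in> J \<Longrightarrow> m \<le> card (cosets (ipow (P j) (r j)))"
  shows "m \<le> card {t \<in> {1..k}. I t = I i}"
proof (rule ccontr)
  define T where "T = {t \<in> {1..k}. I t = I i}"
  assume "\<not> m \<le> card {t \<in> {1..k}. I t = I i}"
  then have mT: "card T < m" by (simp add: T_def)
  define A where "A = I i"
  have I: "ideal (I j) R" "I j \<noteq> {0}" "\<alpha> j \<in> S" if "j \<in> {1..k}" for j
    using cov that unfolding exact_covering_system_def by auto
  have unique: "\<exists>!j. j \<in> {1..k} \<and> x - \<alpha> j \<in> I j" if "x \<in> S" for x
    using cov that unfolding exact_covering_system_def a_l_coset_eq mem_coset_iff R_sel(5) by blast
  have A: "ideal A R" "A \<noteq> {0}" using I[OF i] by (auto simp: A_def)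
  have JD: "j \<in> {1..k}" "I j \<noteq> A" if "j \<in> J" for j using that J(1) by (auto simp: A_def)
  have TD: "t \<in> {1..k}" "I t = A" if "t \<in> T" for t using that by (auto simp: T_def A_def)
  have TJ: "{1..k} = T \<union> J" "T \<inter> J = {}" "finite T" "finite J"
    unfolding T_def J(1) by auto
  define Ps where "Ps = P ` J"
  have Ps: "finite Ps" "Ps \<noteq> {}" using TJ(4) J(2) by (auto simp: Ps_def)
  have prime: "primeideal Q R" "Q \<noteq> {0}" if "Q \<in> Ps" for Q
    using that P by (auto simp: Ps_def)
  \<comment> \<open>Among the indices with prime \<open>Q\<close> take the least exponent: this
    makes \<open>E Q\<close>, which is \<open>A\<close> divided by that power of \<open>Q\<close>,
    as small as possible. The bound \<open>m\<close> is available for every exponent, so also for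
    this one.\<close>
  define sel where "sel Q = arg_min_on r {j \<in> J. P j = Q}" for Q
  have sel: "sel Q \<in> J" "P (sel Q) = Q" if "Q \<in> Ps" for Q
  proof -
    have "sel Q \<in> {j \<in> J. P j = Q}"
      unfolding sel_def using that TJ(4) by (intro arg_min_if_finite) (auto simp: Ps_def)
    then show "sel Q \<in> J" "P (sel Q) = Q" by auto
  qed
  have sel_le: "r (sel (P j)) \<le> r j" if "j \<in> J" for j
    unfolding sel_def using that TJ(4) by (intro arg_min_least) auto
  define \<rho> where "\<rho> Q = r (sel Q)" for Q
  define E where "E Q = (A <+>\<^bsub>R\<^esub> I (sel Q)) \<star> D (sel Q)" for Q
  have B: "ideal (A <+>\<^bsub>R\<^esub> I j) R" if "j \<in> J" for j
    by (intro ideal_set_add A I JD that)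
  have E: "ideal (E Q) R" "E Q \<star> ipow Q (\<rho> Q) = A" if "Q \<in> Ps" for Q
  proof -
    show "ideal (E Q) R" unfolding E_def by (intro ideal_iprod B D sel that)
    show "E Q \<star> ipow Q (\<rho> Q) = A"
      using D(2)[OF sel(1)[OF that]] sel(2)[OF that] unfolding E_def \<rho>_def A_def by simp
  qed
  have E0: "E Q \<noteq> {0}" if Q: "Q \<in> Ps" for Q
  proof
    assume "E Q = {0}"
    then have "A \<subseteq> {0}"
      using iprod_le(1)[OF E(1)[OF Q] ideal_ipow[OF primeD(1)[OF prime(1)[OF Q]]], of "\<rho> Q"] E(2)[OF Q] by simp
    then show False using A ideal_memD(3)[OF A(1)] by blast
  qed
  have ipow0: "ipow Q n \<noteq> {0}" if Q: "Q \<in> Ps" for Q n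
  proof -
    obtain q where q: "q \<in> Q" "q \<noteq> 0" using nonzero_elem[OF primeD(1)[OF prime(1)[OF Q]] prime(2)[OF Q]] by blast
    have "q ^ n \<in> ipow Q n"
    proof (induction n)
      case 0 show ?case unfolding ipow_0 using one_mem by simp
    next
      case (Suc n)
      show ?case unfolding ipow_Suc power_Suc2 by (intro iprodI Suc q)
    qed
    moreover have "q ^ n \<noteq> 0" using q(2) by simp
    ultimately show ?thesis by blast
  qed
  \<comment> \<open>Cancelling the smaller power from two factorisations of \<open>A\<close>
    exhibits \<open>E (P j)\<close> as a multiple of \<open>(A + I j) \<star> D j\<close>.\<close>
  have E_sub: "E (P j) \<subseteq> A <+>\<^bsub>R\<^esub> I j" if j: "j \<in> J" for j
  proof -
    let ?Q = "P j" and ?C = "(A <+>\<^bsub>R\<^esub> I j) \<star> D j"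
    have Q: "?Q \<in> Ps" using j by (auto simp: Ps_def)
    note QI = primeD(1)[OF prime(1)[OF Q]]
    let ?s = "r j - \<rho> ?Q"
    have C: "ideal ?C R" by (intro ideal_iprod B D j)
    have pw: "ideal (ipow ?Q n) R" for n by (rule ideal_ipow[OF QI])
    have CA: "?C \<star> ipow ?Q (r j) = A" using D(2)[OF j] by (simp add: A_def)
    have "r j = ?s + \<rho> ?Q" using sel_le[OF j] by (simp add: \<rho>_def)
    then have "ipow ?Q (r j) = ipow ?Q ?s \<star> ipow ?Q (\<rho> ?Q)" using ipow_add[OF QI] by metis
    then have "?C \<star> ipow ?Q ?s \<star> ipow ?Q (\<rho> ?Q) = A"
      using CA iprod_assoc[OF C pw pw] by metis
    then have "?C \<star> ipow ?Q ?s \<star> ipow ?Q (\<rho> ?Q) = E ?Q \<star> ipow ?Q (\<rho> ?Q)"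
      using E(2)[OF Q] by (rule trans[OF _ sym])
    then have "ipow ?Q (\<rho> ?Q) \<star> (?C \<star> ipow ?Q ?s) = ipow ?Q (\<rho> ?Q) \<star> E ?Q"
      using iprod_commute[OF pw ideal_iprod[OF C pw]] iprod_commute[OF pw E(1)[OF Q]] by metis
    then have "?C \<star> ipow ?Q ?s = E ?Q"
      by (rule invertible_cancel[OF invertible_nonzero[OF pw ipow0[OF Q]] ideal_iprod[OF C pw] E(1)[OF Q]])
    then have "E ?Q \<subseteq> ?C" using iprod_le(1)[OF C pw] by metis
    also have "?C \<subseteq> A <+>\<^bsub>R\<^esub> I j" by (rule iprod_le(1)[OF B[OF j] D(1)[OF j]])
    finally show ?thesis .
  qed
  have "\<exists>u. u \<in> S \<and> 1 - u \<in> ipow Q (\<rho> Q) \<and> (\<forall>Q'\<in>Ps - {Q}. u \<in> ipow Q' (\<rho> Q'))" if Q: "Q \<in> Ps" for Q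
  proof -
    have "\<And>Q'. Q' \<in> Ps - {Q} \<Longrightarrow> primeideal Q' R \<and> Q' \<noteq> {0} \<and> Q' \<noteq> Q" using prime by blast
    then show ?thesis
      using crt_idempotent[OF prime[OF Q], of "Ps - {Q}" "\<rho> Q" \<rho>] Ps(1) by (metis finite_Diff)
  qed
  then obtain u where u: "\<And>Q. Q \<in> Ps \<Longrightarrow> u Q \<in> S" "\<And>Q. Q \<in> Ps \<Longrightarrow> 1 - u Q \<in> ipow Q (\<rho> Q)"
    "\<And>Q Q'. Q \<in> Ps \<Longrightarrow> Q' \<in> Ps \<Longrightarrow> Q' \<noteq> Q \<Longrightarrow> u Q \<in> ipow Q' (\<rho> Q')"
    by (metis Diff_iff singletonD)
  \<comment> \<open>\<open>u Q * (\<alpha> t - \<alpha> i)\<close> is the component at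
    \<open>Q\<close> of the step from \<open>\<alpha> i\<close> to \<open>\<alpha> t\<close>. At
    most \<open>card T\<close> such values must be avoided, fewer than there are residues modulo
    \<open>ipow Q (\<rho> Q)\<close>.\<close>
  have "\<exists>h. h \<in> E Q \<and> (\<forall>t\<in>T. h - u Q * (\<alpha> t - \<alpha> i) \<notin> A)" if Q: "Q \<in> Ps" for Q
  proof -
    let ?T = "(\<lambda>t. u Q * (\<alpha> t - \<alpha> i)) ` T"
    have "card ?T \<le> card T" by (rule card_image_le[OF TJ(3)])
    also have "\<dots> < m" by (rule mT)
    also have "m \<le> card (cosets (ipow Q (\<rho> Q)))"
      using m[OF sel(1)[OF Q]] sel(2)[OF Q] by (simp only: \<rho>_def)
    finally obtain h where "h \<in> E Q" "\<And>t. t \<in> ?T \<Longrightarrow> h - t \<notin> E Q \<star> ipow Q (\<rho> Q)"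
      using avoid_cosets[OF prime[OF Q] E(1)[OF Q] E0[OF Q] finite_imageI[OF TJ(3)]] by blast
    then show ?thesis unfolding E(2)[OF Q] by blast
  qed
  then obtain h where h: "\<And>Q. Q \<in> Ps \<Longrightarrow> h Q \<in> E Q"
    "\<And>Q t. Q \<in> Ps \<Longrightarrow> t \<in> T \<Longrightarrow> h Q - u Q * (\<alpha> t - \<alpha> i) \<notin> A"
    by metis
  have hS: "h Q \<in> S" if "Q \<in> Ps" for Q using ideal_memD(2)[OF E(1) h(1)] that by blast
  define x where "x U = \<alpha> i + (\<Sum>Q\<in>U. h Q)" for U
  have xS: "x U \<in> S" if "U \<subseteq> Ps" for U
    unfolding x_def using that by (intro add_mem sum_mem I i hS) auto
  \<comment> \<open>Multiplication by \<open>u Q\<close> for some \<open>Q \<in> U\<close> isolates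
    one summand: modulo \<open>A\<close> it kills \<open>h Q'\<close> for
    \<open>Q' \<noteq> Q\<close> and fixes \<open>h Q\<close>, since
    \<open>E Q' \<star> ipow Q' (\<rho> Q') = A\<close> for each prime. What remains contradicts the
    choice of \<open>h Q\<close>.\<close>
  have x_avoid: "x U - \<alpha> t \<notin> A" if U: "U \<subseteq> Ps" "U \<noteq> {}" and t: "t \<in> T" for U t
  proof
    assume "x U - \<alpha> t \<in> A"
    obtain Q where Q: "Q \<in> U" "Q \<in> Ps" using U by blast
    have EA: "y * z \<in> A" if "Q' \<in> Ps" "y \<in> E Q'" "z \<in> ipow Q' (\<rho> Q')" for Q' y z
      using iprodI[OF that(2,3)] E(2)[OF that(1)] by metis
    have "u Q * (x U - \<alpha> t) \<in> A" by (rule ideal_memD(5)[OF A(1) u(1)[OF Q(2)] \<open>x U - \<alpha> t \<in> A\<close>])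
    moreover have "(\<Sum>Q'\<in>U - {Q}. h Q' * u Q) \<in> A"
    proof (rule ideal_sum_mem[OF A(1)])
      fix Q' assume "Q' \<in> U - {Q}"
      then have Q': "Q' \<in> Ps" "Q' \<noteq> Q" using U(1) by blast+
      show "h Q' * u Q \<in> A" by (rule EA[OF Q'(1) h(1)[OF Q'(1)] u(3)[OF Q(2) Q']])
    qed
    ultimately have "u Q * (x U - \<alpha> t) - (\<Sum>Q'\<in>U - {Q}. h Q' * u Q) \<in> A"
      by (rule ideal_memD(8)[OF A(1)])
    moreover have "h Q * (1 - u Q) \<in> A" by (intro EA[OF Q(2)] h(1) u(2) Q)
    ultimately have "u Q * (x U - \<alpha> t) - (\<Sum>Q'\<in>U - {Q}. h Q' * u Q) + h Q * (1 - u Q) \<in> A"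
      by (rule ideal_memD(4)[OF A(1)])
    also have "x U = \<alpha> i + (h Q + (\<Sum>Q'\<in>U - {Q}. h Q'))"
      unfolding x_def using Q(1) finite_subset[OF U(1) Ps(1)] by (simp add: sum.remove)
    also have "u Q * (\<alpha> i + (h Q + (\<Sum>Q'\<in>U - {Q}. h Q')) - \<alpha> t)
        - (\<Sum>Q'\<in>U - {Q}. h Q' * u Q) + h Q * (1 - u Q) = h Q - u Q * (\<alpha> t - \<alpha> i)"
      unfolding sum_distrib_right[symmetric] by (simp add: algebra_simps)
    finally show False using h(2)[OF Q(2) t] by blast
  qed

  have "\<exists>b. b \<noteq> 0 \<and> b \<in> I j" if "j \<in> {1..k}" for j
    by (rule nonzero_elem[OF I(1)[OF that] I(2)[OF that]]) blast
  then obtain \<beta> where \<beta>: "\<And>j. j \<in> {1..k} \<Longrightarrow> \<beta> j \<noteq> 0 \<and> \<beta> j \<in> I j" by metis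
  \<comment> \<open>A product of nonzero elements of all the \<open>I j\<close> generates a nonzero
    ideal \<open>M\<close> inside every \<open>I j\<close>, so averages over \<open>A\<close> become
    finite counts over the cosets of \<open>M\<close> in \<open>A\<close>.\<close>
  define b where "b = (\<Prod>j\<in>{1..k}. \<beta> j)"
  have b0: "b \<noteq> 0" using \<beta> by (simp add: b_def)
  have prodS: "(\<Prod>j\<in>F. \<beta> j) \<in> S" if "F \<subseteq> {1..k}" for F
    using that
  proof (induction F rule: infinite_finite_induct)
    case (insert j F)
    then have "\<beta> j \<in> S" using \<beta> I(1) ideal_memD(2) by blast
    with insert show ?case by (simp add: mult_mem)
  qed (simp_all add: one_mem)
  have bI: "b \<in> I j" if j: "j \<in> {1..k}" for j
  proof -
    have "b = \<beta> j * (\<Prod>j\<in>{1..k} - {j}. \<beta> j)" unfolding b_def using j by (intro prod.remove) auto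
    also have "\<dots> \<in> I j" using \<beta>[OF j] by (intro ideal_memD(6)[OF I(1)[OF j]] prodS) auto
    finally show ?thesis .
  qed
  have bS: "b \<in> S" unfolding b_def by (intro prodS) simp
  define M where "M = (*) b ` S"
  have M: "ideal M R" unfolding M_def by (rule principal_ideal[OF bS])
  have "b * 1 \<in> M" unfolding M_def using one_mem by blast
  then have M0: "M \<noteq> {0}" using b0 by auto
  have MI: "M \<subseteq> I j" if "j \<in> {1..k}" for j
    unfolding M_def using ideal_memD(6)[OF I(1)[OF that] _ bI[OF that]] by blast
  \<comment> \<open>\<open>card (W j y)\<close> is, up to a factor, the average over \<open>A\<close> of the indicator function of the \<open>j\<close>-th
    class, translated by \<open>y\<close>; averaging makes it periodic under \<open>A + I j\<close>.\<close>
  define Z where "Z = (\<lambda>a. (+) a ` M) ` A"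
  define W where "W j y = {z \<in> Z. (+) y ` z \<subseteq> (+) (\<alpha> j) ` I j}" for j y
  have Z: "finite Z" "Z \<noteq> {}"
  proof -
    have "Z \<subseteq> cosets M" unfolding Z_def using ideal_memD(1)[OF A(1)] by (rule image_mono)
    then show "finite Z" using finite_cosets[OF M M0] finite_subset by blast
    show "Z \<noteq> {}" using ideal_memD(3)[OF A(1)] by (auto simp: Z_def)
  qed
  have finW: "finite (W j y)" for j y using Z(1) by (simp add: W_def)
  have W_iff: "(+) a ` M \<in> W j y \<longleftrightarrow> y + a - \<alpha> j \<in> I j" if "a \<in> A" "j \<in> {1..k}" for a j y
  proof -
    have "(+) y ` (+) a ` M = (+) (y + a) ` M" by (simp add: image_image add.assoc)
    moreover have "(+) a ` M \<in> Z" using that(1) unfolding Z_def by blast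
    ultimately show ?thesis unfolding W_def using coset_subset_iff[OF M I(1)[OF that(2)] MI[OF that(2)]] by simp
  qed
  \<comment> \<open>Every \<open>y + a\<close> lies in exactly one class of the cover, so the sets
    \<open>W j y\<close> partition \<open>Z\<close>.\<close>
  have W_total: "(\<Sum>j\<in>{1..k}. card (W j y)) = card Z" if y: "y \<in> S" for y
  proof -
    have U: "\<exists>!j. j \<in> {1..k} \<and> z \<in> W j y" if z: "z \<in> Z" for z
    proof -
      obtain a where a: "a \<in> A" "z = (+) a ` M" using z unfolding Z_def by blast
      have "y + a \<in> S" by (intro add_mem y ideal_memD(2)[OF A(1) a(1)])
      from unique[OF this] show ?thesis using W_iff[OF a(1)] unfolding a(2) by blast
    qed
    have WZ: "W j y \<subseteq> Z" for j unfolding W_def by blast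
    have "(\<Sum>j\<in>{1..k}. card (W j y)) = card (\<Union>j\<in>{1..k}. W j y)"
    proof (rule card_UN_disjoint[symmetric])
      show "\<forall>j\<in>{1..k}. \<forall>j'\<in>{1..k}. j \<noteq> j' \<longrightarrow> W j y \<inter> W j' y = {}"
        using U WZ by blast
    qed (use finW in simp_all)
    also have "(\<Union>j\<in>{1..k}. W j y) = Z" using U WZ by blast
    finally show ?thesis .
  qed
  \<comment> \<open>Write \<open>c = a + v\<close>: the part \<open>v \<in> I j\<close> does not
    change membership in the class, and translation by \<open>a \<in> A\<close> permutes the cosets
    in \<open>Z\<close>.\<close>
  have W_shift: "card (W j (y + c)) = card (W j y)" if j: "j \<in> J" and c: "c \<in> A <+>\<^bsub>R\<^esub> I j" for j y c
  proof -
    note jk = JD(1)[OF j]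
    note Ij = ideal_memD[OF I(1)[OF jk]] and AI = ideal_memD[OF A(1)]
    obtain a v where av: "a \<in> A" "v \<in> I j" "c = a + v" using c unfolding mem_set_add_iff by blast
    have im: "(`) ((+) a) ((+) a' ` M) = (+) (a + a') ` M" for a' by (simp add: image_image add.assoc)
    have "(`) ((+) a) ` W j (y + c) = W j y"
    proof safe
      fix z assume z: "z \<in> W j (y + c)"
      then obtain a' where a': "a' \<in> A" "z = (+) a' ` M" unfolding W_def Z_def by blast
      have "y + c + a' - \<alpha> j \<in> I j" using z W_iff[OF a'(1) jk] unfolding a'(2) by blast
      then have "y + c + a' - \<alpha> j - v \<in> I j" using Ij(8) av(2) by blast
      then have "y + (a + a') - \<alpha> j \<in> I j" unfolding av(3) by (simp add: algebra_simps)
      then show "(+) a ` z \<in> W j y" unfolding a'(2) im using W_iff[OF AI(4)[OF av(1) a'(1)] jk] by blast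
    next
      fix z assume z: "z \<in> W j y"
      then obtain a' where a': "a' \<in> A" "z = (+) a' ` M" unfolding W_def Z_def by blast
      have "y + a' - \<alpha> j \<in> I j" using z W_iff[OF a'(1) jk] unfolding a'(2) by blast
      then have "y + a' - \<alpha> j + v \<in> I j" using Ij(4) av(2) by blast
      then have "y + c + (a' - a) - \<alpha> j \<in> I j" unfolding av(3) by (simp add: algebra_simps)
      then have "(+) (a' - a) ` M \<in> W j (y + c)" using W_iff[OF AI(8)[OF a'(1) av(1)] jk] by blast
      moreover have "z = (+) a ` (+) (a' - a) ` M" unfolding im a'(2) by simp
      ultimately show "z \<in> (`) ((+) a) ` W j (y + c)" by blast
    qed
    moreover have "inj_on ((`) ((+) a)) (W j (y + c))"
      by (rule inj_onI) (simp add: inj_image_eq_iff)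
    ultimately show ?thesis using card_image by metis
  qed
  have W_base: "W j (x {}) = {}" if j: "j \<in> J" for j
  proof (rule ccontr)
    assume "W j (x {}) \<noteq> {}"
    then obtain a where a: "a \<in> A" "(+) a ` M \<in> W j (x {})" unfolding W_def Z_def by blast
    then have "\<alpha> i + a - \<alpha> j \<in> I j" using W_iff[OF a(1) JD(1)[OF j]] by (simp add: x_def)
    moreover have "\<alpha> i + a - \<alpha> i \<in> I i" using a(1) by (simp add: A_def)
    moreover have "\<alpha> i + a \<in> S" by (intro add_mem I i ideal_memD(2)[OF A(1) a(1)])
    ultimately have "j = i" using unique JD(1)[OF j] i by blast
    then show False using JD(2)[OF j] by (simp add: A_def)
  qed
  have W_T: "W t (x U) = {}" if U: "U \<subseteq> Ps" "U \<noteq> {}" and t: "t \<in> T" for t U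
  proof (rule ccontr)
    assume "W t (x U) \<noteq> {}"
    then obtain a where a: "a \<in> A" "(+) a ` M \<in> W t (x U)" unfolding W_def Z_def by blast
    then have "x U + a - \<alpha> t \<in> A" using W_iff[OF a(1) TD(1)[OF t]] TD(2)[OF t] by simp
    then have "x U + a - \<alpha> t - a \<in> A" using ideal_memD(8)[OF A(1) _ a(1)] by blast
    then show False using x_avoid[OF U t] by (simp add: algebra_simps)
  qed
  \<comment> \<open>\<open>H U\<close> counts the cosets sent by \<open>x U\<close> into classes
    outside \<open>T\<close>: none for \<open>U = {}\<close>, all of \<open>Z\<close> for every
    other \<open>U\<close>.\<close>
  define H where "H U = (\<Sum>j\<in>J. int (card (W j (x U))))" for U
  have H_base: "H {} = 0" unfolding H_def by (simp add: W_base)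
  have H_other: "H U = int (card Z)" if U: "U \<subseteq> Ps" "U \<noteq> {}" for U
  proof -
    have "int (card Z) = (\<Sum>j\<in>T \<union> J. int (card (W j (x U))))"
      unfolding W_total[OF xS[OF U(1)], symmetric] TJ(1)[symmetric] by simp
    also have "\<dots> = (\<Sum>j\<in>T. int (card (W j (x U)))) + H U"
      unfolding H_def using TJ by (intro sum.union_disjoint) auto
    also have "(\<Sum>j\<in>T. int (card (W j (x U)))) = 0" using W_T[OF U] by simp
    finally show ?thesis by simp
  qed
  obtain q where q: "q \<in> Ps" using Ps(2) by blast
  \<comment> \<open>A constant is invariant in any direction; one direction \<open>q\<close> exists
    because \<open>J\<close> is nonempty.\<close>
  have "(\<Sum>U\<in>Pow Ps. (- 1) ^ card U * int (card Z)) = 0"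
    by (rule alternating_sum_Pow_eq_0[OF Ps(1) q]) simp
  moreover have "(\<Sum>U\<in>Pow Ps. (- 1) ^ card U * H U) = 0"
  proof -
    have "(\<Sum>U\<in>Pow Ps. (- 1) ^ card U * H U)
        = (\<Sum>j\<in>J. \<Sum>U\<in>Pow Ps. (- 1) ^ card U * int (card (W j (x U))))"
      unfolding H_def sum_distrib_left by (rule sum.swap)
    also have "\<dots> = (\<Sum>j\<in>J. 0)"
    proof (rule sum.cong[OF refl])
      fix j assume j: "j \<in> J"
      then have Pj: "P j \<in> Ps" by (simp add: Ps_def)
      show "(\<Sum>U\<in>Pow Ps. (- 1) ^ card U * int (card (W j (x U)))) = 0"
      proof (rule alternating_sum_Pow_eq_0[OF Ps(1) Pj])
        \<comment> \<open>Adding \<open>P j\<close> to \<open>U\<close> translates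
          \<open>x U\<close> by \<open>h (P j)\<close>, a period of the \<open>j\<close>-th
          count.\<close>
        fix U assume U: "U \<subseteq> Ps - {P j}"
        then have "finite U" "P j \<notin> U" using finite_subset[OF _ Ps(1), of U] by auto
        then have "x (insert (P j) U) = x U + h (P j)" by (simp add: x_def)
        moreover have "h (P j) \<in> A <+>\<^bsub>R\<^esub> I j" using h(1)[OF Pj] E_sub[OF j] by blast
        ultimately show "int (card (W j (x (insert (P j) U)))) = int (card (W j (x U)))"
          using W_shift[OF j] by simp
      qed
    qed
    finally show ?thesis by simp
  qed
  ultimately have "0 = (\<Sum>U\<in>Pow Ps. (- 1) ^ card U * (int (card Z) - H U))"
    by (simp only: right_diff_distrib sum_subtractf)
  \<comment> \<open>Only \<open>U = {}\<close> survives, with the value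
    \<open>card Z\<close>.\<close>
  also have "\<dots> = (\<Sum>U\<in>{{}}. (- 1) ^ card U * (int (card Z) - H U))"
    using Ps(1) H_other by (intro sum.mono_neutral_right) auto
  finally have "card Z = 0" by (simp add: H_base)
  then show False using Z by simp
qed

section \<open>Evaluating \<open>max_prime_power_norm\<close> and \<open>ideal_quotient\<close>, and
  the main bound\<close>

text \<open>Every ideal containing \<open>A\<close> is a union of cosets of \<open>A\<close>, so
  there are finitely many and a maximal proper one exists. It is a maximal ideal, hence prime, and
  it is nonzero since it contains \<open>A\<close>.\<close>

lemma exists_nonzero_prime:
  assumes A: "ideal A R" "A \<noteq> {0}" "A \<noteq> S"
  obtains P where "primeideal P R" "P \<noteq> {0}"
proof -
  define \<I> where "\<I> = {B. ideal B R \<and> A \<subseteq> B \<and> B \<noteq> S}"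
  have "\<I> \<subseteq> \<Union> ` Pow (cosets A)"
  proof
    fix B assume "B \<in> \<I>"
    then have B: "ideal B R" "A \<subseteq> B" by (auto simp: \<I>_def)
    have "B = \<Union> ((\<lambda>x. (+) x ` A) ` B)"
    proof
      show "B \<subseteq> \<Union> ((\<lambda>x. (+) x ` A) ` B)"
      proof
        fix x assume "x \<in> B"
        moreover have "x \<in> (+) x ` A" using ideal_memD(3)[OF A(1)] by (simp add: mem_coset_iff)
        ultimately show "x \<in> \<Union> ((\<lambda>x. (+) x ` A) ` B)" by blast
      qed
      show "\<Union> ((\<lambda>x. (+) x ` A) ` B) \<subseteq> B" using B(2) ideal_memD(4)[OF B(1)] by blast
    qed
    moreover have "(\<lambda>x. (+) x ` A) ` B \<in> Pow (cosets A)" using ideal_memD(1)[OF B(1)] by blast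
    ultimately show "B \<in> \<Union> ` Pow (cosets A)" by blast
  qed
  then have "finite \<I>" using finite_cosets[OF A(1,2)] by (meson finite_Pow_iff finite_imageI finite_subset)
  moreover have "A \<in> \<I>" using A by (simp add: \<I>_def)
  ultimately obtain P where P: "P \<in> \<I>" "\<And>B. B \<in> \<I> \<Longrightarrow> P \<subseteq> B \<Longrightarrow> P = B"
    using finite_has_maximal[of \<I>] by blast
  have PD: "ideal P R" "A \<subseteq> P" "P \<noteq> S" using P(1) by (auto simp: \<I>_def)
  have "maximalideal P R"
  proof (rule maximalidealI[OF PD(1)])
    show "carrier R \<noteq> P" using PD(3) by simp
    fix B assume B: "ideal B R" "P \<subseteq> B" "B \<subseteq> carrier R"
    show "B = P \<or> B = carrier R"
    proof (cases "B = S")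
      case False
      then have "B \<in> \<I>" using B PD(2) by (auto simp: \<I>_def)
      then show ?thesis using P(2) B(2) by blast
    qed simp
  qed
  then have "primeideal P R" by (rule R.maximalideal_prime)
  moreover obtain a where "a \<in> A" "a \<noteq> 0" using nonzero_elem[OF A(1,2)] by blast
  then have "P \<noteq> {0}" using PD(2) by blast
  ultimately show ?thesis using that by blast
qed

lemma card_cosets_antimono:
  assumes A: "ideal A R" "A \<noteq> {0}" and B: "ideal B R" "A \<subseteq> B"
  shows "card (cosets B) \<le> card (cosets A)"
proof (rule surj_card_le[OF finite_cosets[OF A]])
  show "cosets B \<subseteq> (\<lambda>z. (+) (SOME y. y \<in> z) ` B) ` cosets A"
  proof safe
    fix x assume x: "x \<in> S"
    have "x \<in> (+) x ` A" using ideal_memD(3)[OF A(1)] by (simp add: mem_coset_iff)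
    then have "(SOME y. y \<in> (+) x ` A) \<in> (+) x ` A" by (rule someI)
    then have "(SOME y. y \<in> (+) x ` A) - x \<in> B" using B(2) unfolding mem_coset_iff by blast
    then have "(+) x ` B = (+) (SOME y. y \<in> (+) x ` A) ` B" using coset_eq_iff[OF B(1)] by blast
    then show "(+) x ` B \<in> (\<lambda>z. (+) (SOME y. y \<in> z) ` B) ` cosets A" using x by blast
  qed
qed

text \<open>\<open>Max\<close> is meaningful only on a finite nonempty set. The norms are bounded by
  that of \<open>C\<close>, because a divisor contains \<open>C\<close>; nonemptiness comes from the
  zeroth power of \<open>P0\<close>, which divides everything.\<close>

lemma max_prime_power_norm_attained:
  assumes C: "ideal C R" "C \<noteq> {0}" and ex: "primeideal P0 R" "P0 \<noteq> {0}"
  obtains P r F where "primeideal P R" "P \<noteq> {0}" "ideal F R" "ipow P r \<star> F = C"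
    "max_prime_power_norm R C = card (cosets (ipow P r))"
proof -
  define N where "N = {ideal_norm R (ipow P r) | P r.
            primeideal P R \<and> P \<noteq> {\<zero>\<^bsub>R\<^esub>} \<and> ipow P r divides\<^bsub>ideals_set R\<^esub> C}"
  have dvd: "ipow P r divides\<^bsub>ideals_set R\<^esub> C \<longleftrightarrow> (\<exists>F. ideal F R \<and> ipow P r \<star> F = C)" for P r
    unfolding factor_def ideals_set_def by (simp only: partial_object.simps monoid.simps) blast
  have "N \<subseteq> {..card (cosets C)}"
  proof
    fix n assume "n \<in> N"
    then obtain P r F where P: "primeideal P R" "ideal F R" "ipow P r \<star> F = C" "n = card (cosets (ipow P r))"
      unfolding N_def dvd ideal_norm_eq by blast
    have Pr: "ideal (ipow P r) R" by (rule ideal_ipow[OF primeD(1)[OF P(1)]])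
    have "C \<subseteq> ipow P r" using iprod_le(1)[OF Pr P(2)] unfolding P(3) .
    then show "n \<in> {..card (cosets C)}" using card_cosets_antimono[OF C Pr] P(4) by blast
  qed
  then have "finite N" using finite_subset by blast
  moreover have "ideal_norm R (ipow P0 0) \<in> N"
  proof -
    have "ipow P0 0 \<star> C = C"
      unfolding ipow_0 using iprod_commute[OF ideal_S C(1)] iprod_S[OF C(1)] by metis
    then have "ipow P0 0 divides\<^bsub>ideals_set R\<^esub> C" unfolding dvd using C(1) by blast
    then show ?thesis unfolding N_def R_sel(3) using ex by blast
  qed
  ultimately have "Max N \<in> N" by (intro Max_in) blast+
  then obtain P r F where "primeideal P R" "P \<noteq> {0}" "ideal F R" "ipow P r \<star> F = C" "Max N = card (cosets (ipow P r))"
    unfolding N_def dvd ideal_norm_eq R_sel(3) by blast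
  moreover have "max_prime_power_norm R C = Max N"
    unfolding max_prime_power_norm_def N_def ..
  ultimately show ?thesis using that by metis
qed

text \<open>Invertibility of \<open>B\<close> gives existence by \<open>invertible_divides\<close>
  and uniqueness by cancellation, so the definite description denotes.\<close>

lemma ideal_quotient_spec:
  assumes A: "ideal A R" and B: "ideal B R" "B \<noteq> {0}" "A \<subseteq> B"
  shows "ideal (ideal_quotient R A B) R" "B \<star> ideal_quotient R A B = A"
proof -
  note inv = invertible_nonzero[OF B(1,2)]
  obtain C where C: "ideal C R" "B \<star> C = A" using invertible_divides[OF inv A B(3)] by blast
  have "ideal (ideal_quotient R A B) R \<and> B \<star> ideal_quotient R A B = A"
    unfolding ideal_quotient_def
  proof (rule theI)
    show "ideal C R \<and> B \<star> C = A" using C by blast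
    show "C' = C" if "ideal C' R \<and> B \<star> C' = A" for C'
      using that C invertible_cancel[OF inv] by metis
  qed
  then show "ideal (ideal_quotient R A B) R" "B \<star> ideal_quotient R A B = A" by blast+
qed

theorem exact_covering_multiplicity:
  assumes cov: "exact_covering_system R k \<alpha> I" and ne: "\<exists>s\<in>{1..k}. \<exists>t\<in>{1..k}. I s \<noteq> I t"
    and i: "i \<in> {1..k}"
  shows "Min {max_prime_power_norm R (ideal_quotient R (I i) (I i <+>\<^bsub>R\<^esub> I j)) | j. j \<in> {1..k} \<and> I j \<noteq> I i}
    \<le> card {t \<in> {1..k}. I t = I i}"
proof -
  define J where "J = {j \<in> {1..k}. I j \<noteq> I i}"
  define g where "g j = max_prime_power_norm R (ideal_quotient R (I i) (I i <+>\<^bsub>R\<^esub> I j))" for j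
  have I: "ideal (I j) R" "I j \<noteq> {0}" "I j \<noteq> S" if "j \<in> {1..k}" for j
    using cov that unfolding exact_covering_system_def by auto
  obtain P0 where P0: "primeideal P0 R" "P0 \<noteq> {0}"
    using exists_nonzero_prime[OF I[OF i]] by blast
  have "J \<noteq> {}" using ne unfolding J_def by auto
  \<comment> \<open>A prime power attaining \<open>g j\<close> together with its cofactor
    \<open>F\<close>; one predicate allows a simultaneous choice over all \<open>j\<close>.\<close>
  define adm where "adm j P r F \<longleftrightarrow> primeideal P R \<and> P \<noteq> {0} \<and> ideal F R \<and>
      (I i <+>\<^bsub>R\<^esub> I j) \<star> F \<star> ipow P r = I i \<and> g j = card (cosets (ipow P r))" for j P r F
  have "\<exists>P r F. adm j P r F" if "j \<in> J" for j
  proof -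
    have j: "j \<in> {1..k}" using that by (simp add: J_def)
    let ?B = "I i <+>\<^bsub>R\<^esub> I j"
    have B: "ideal ?B R" "I i \<subseteq> ?B"
      by (rule ideal_set_add subset_set_add(1), (rule I(1)[OF i] I(1)[OF j])+)+
    have B0: "?B \<noteq> {0}" using B(2) I(2)[OF i] ideal_memD(3)[OF I(1)[OF i]] by blast
    define C where "C = ideal_quotient R (I i) ?B"
    have C: "ideal C R" "?B \<star> C = I i"
      unfolding C_def using ideal_quotient_spec[OF I(1)[OF i] B(1) B0 B(2)] by blast+
    have "C \<noteq> {0}"
    proof
      assume "C = {0}"
      then have "I i \<subseteq> {0}" using iprod_le(2)[OF B(1) C(1)] C(2) by metis
      then show False using I(2)[OF i] ideal_memD(3)[OF I(1)[OF i]] by blast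
    qed
    then obtain P r F where P: "primeideal P R" "P \<noteq> {0}" "ideal F R" "ipow P r \<star> F = C"
        "max_prime_power_norm R C = card (cosets (ipow P r))"
      using max_prime_power_norm_attained[OF C(1) _ P0] by blast
    have Pr: "ideal (ipow P r) R" by (rule ideal_ipow[OF primeD(1)[OF P(1)]])
    have "?B \<star> F \<star> ipow P r = ?B \<star> (F \<star> ipow P r)" by (rule iprod_assoc[OF B(1) P(3) Pr])
    also have "F \<star> ipow P r = C" using iprod_commute[OF P(3) Pr] P(4) by metis
    finally have "?B \<star> F \<star> ipow P r = I i" unfolding C(2) .
    then show ?thesis using P(1,2,3,5) unfolding adm_def g_def C_def by blast
  qed
  then obtain P r F where "\<And>j. j \<in> J \<Longrightarrow> adm j (P j) (r j) (F j)"
    by metis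
  then have P: "\<And>j. j \<in> J \<Longrightarrow> primeideal (P j) R" "\<And>j. j \<in> J \<Longrightarrow> P j \<noteq> {0}"
     "\<And>j. j \<in> J \<Longrightarrow> ideal (F j) R"
     "\<And>j. j \<in> J \<Longrightarrow> (I i <+>\<^bsub>R\<^esub> I j) \<star> F j \<star> ipow (P j) (r j) = I i"
     "\<And>j. j \<in> J \<Longrightarrow> g j = card (cosets (ipow (P j) (r j)))"
    unfolding adm_def by blast+
  have "Min (g ` J) \<le> card {t \<in> {1..k}. I t = I i}"
  proof (rule covering_multiplicity[OF cov i J_def \<open>J \<noteq> {}\<close> P(1-4)])
    show "Min (g ` J) \<le> card (cosets (ipow (P j) (r j)))" if "j \<in> J" for j
      unfolding P(5)[OF that, symmetric] using that by (intro Min_le) (auto simp: J_def)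
  qed
  also have "g ` J = {g j | j. j \<in> {1..k} \<and> I j \<noteq> I i}" unfolding J_def by blast
  finally show ?thesis unfolding g_def .
qed

end

theorem theorem2:
  fixes K :: "'a::field_char_0 set"
    and k :: nat
    and \<alpha> :: "nat \<Rightarrow> 'a"
    and I :: "nat \<Rightarrow> 'a set"
    and i :: nat
  assumes "number_field K"
    and "exact_covering_system (ring_of_integers K) k \<alpha> I"
    and "\<exists>s\<in>{1..k}. \<exists>t\<in>{1..k}. I s \<noteq> I t"
    and "i \<in> {1..k}"
  shows "card {t \<in> {1..k}. I t = I i} \<ge>
    Min {max_prime_power_norm (ring_of_integers K)
           (ideal_quotient (ring_of_integers K) (I i) (I i <+>\<^bsub>ring_of_integers K\<^esub> I j))
         | j. j \<in> {1..k} \<and> I j \<noteq> I i}"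
proof -
  interpret number_field_integers K by unfold_locales (rule assms(1))
  \<comment> \<open>Both locales are instantiated at the same set, so their ring \<open>R\<close> is
    the unfolded \<open>ring_of_integers K\<close>.\<close>
  interpret finite_dedekind "{x \<in> K. algebraic_int x}"
    by unfold_locales (rule finite_cosets invertible_nonzero; assumption)+
  show ?thesis
    using exact_covering_multiplicity[of k \<alpha> I i] assms(2-4) unfolding ring_of_integers_def by blast
qed

end
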